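(* Let $(g_i):\ 0\to \mathfrak n_i\xrightarrow{\chi_i}\mathfrak g_i\xrightarrow{\pi_i}\mathfrak q_i\to 0$, $i=1,2$, be $\mathsf{Lie}$-central extensions of Leibniz algebras. The following statements are equivalent: (a) $(g_1)$ and $(g_2)$ are $\mathsf{Lie}$-isoclinic. (b) There exists a $\mathsf{Lie}$-central extension $(g')$ together with $\mathsf{Lie}$-isoclinic epimorphisms from $(g')$ onto $(g_1)$ and onto $(g_2)$. (c) There exists a $\mathsf{Lie}$-central extension $(g'')$ together with $\mathsf{Lie}$-isoclinic monomorphisms from $(g_1)$ and from $(g_2)$ into $(g'')$.
   Context: $\mathbb K$ is a field with $\frac12\in\mathbb K$. A Leibniz algebra is a $\mathbb K$-vector space $\mathfrak q$ with a bilinear bracket satisfying $[x,[y,z]]=[[x,y],z]-[[x,z],y]$; homomorphisms are linear maps preserving the bracket. For two-sided ideals $\mathfrak m,\mathfrak n$ of $\mathfrak q$, $[\mathfrak m,\mathfrak n]_{\mathsf{Lie}}$ is the two-sided ideal of $\mathfrak q$ generated by $\{[m,n]+[n,m] : m\in\mathfrak m,n\in\mathfrak n\}$, and $Z_{\mathsf{Lie}}(\mathfrak q)=\{z\in\mathfrak q : [q,z]+[z,q]=0\ \forall q\in\mathfrak q\}$ (a two-sided ideal). An extension (short exact sequence of Leibniz algebras) $(g):0\to\mathfrak n\xrightarrow{\chi}\mathfrak g\xrightarrow{\pi}\mathfrak q\to0$ is $\mathsf{Lie}$-central if $\chi(\mathfrak n)\subseteq Z_{\mathsf{Lie}}(\mathfrak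 g)$, equivalently $[\chi(\mathfrak n),\mathfrak g]_{\mathsf{Lie}}=0$. Its $\mathsf{Lie}$-commutator map is the well-defined map $C:\mathfrak q\times\mathfrak q\to[\mathfrak g,\mathfrak g]_{\mathsf{Lie}}$, $C(q_1,q_2)=[x_1,x_2]+[x_2,x_1]$ where $\pi(x_j)=q_j$. $\mathsf{Lie}$-central extensions $(g_1),(g_2)$, with commutator maps $C_1,C_2$, are $\mathsf{Lie}$-isoclinic if there are isomorphisms $\eta:\mathfrak q_1\to\mathfrak q_2$ and $\xi:[\mathfrak g_1,\mathfrak g_1]_{\mathsf{Lie}}\to[\mathfrak g_2,\mathfrak g_2]_{\mathsf{Lie}}$ with $\xi\circ C_1=C_2\circ(\eta\times\eta)$; the pair $(\eta,\xi)$ is then called a $\mathsf{Lie}$-isoclinism from $(g_1)$ to $(g_2)$. A homomorphism of $\mathsf{Lie}$-central extensions $(\alpha,\beta,\gamma):(g_1)\to(g_2)$ consists of Leibniz homomorphisms $\alpha:\mathfrak n_1\to\mathfrak n_2$, $\beta:\mathfrak g_1\to\mathfrak g_2$, $\gamma:\mathfrak q_1\to\mathfrak q_2$ with $\chi_2\alpha=\beta\chi_1$, $\pi_2\beta=\gamma\pi_1$. It is $\mathsf{Lie}$-isoclinic if there is an isomorphism $\beta':[\mathfrak g_1,\mathfrak g_1]_{\mathsf{Lie}}\to[\mathfrak g_2,\mathfrak g_2]_{\mathsf{Lie}}$ such that $(\gamma,\beta')$ is a $\mathsf{Lie}$-isoclinism from $(g_1)$ to $(g_2)$; it is a $\mathsf{Lie}$-isoclinic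 epimorphism (resp. monomorphism) if in addition $\beta$ is surjective (resp. injective). *)

theory Defs
  imports Complex_Main "HOL-Library.Product_Plus" "HOL-Library.Function_Algebras"
begin

text \<open>
  The vector space underlying an algebra is a linear subspace (the carrier) of a type of class
  \<open>ab_group_add\<close> on which \<open>scale\<close> is a vector space structure; addition is that of
  the type. Brackets and homomorphisms are functions on the whole type, but only their values on
  the carriers are constrained or used.
\<close>

record ('k, 'a) leibniz =
  lcarrier :: "'a set"
  lscale :: "'k \<Rightarrow> 'a \<Rightarrow> 'a"
  bracket :: "'a \<Rightarrow> 'a \<Rightarrow> 'a"

locale leibniz_algebra = vector_space "lscale G"
  for G :: "('k::field, 'a::ab_group_add) leibniz" +
  assumes subspace_carrier: "subspace (lcarrier G)"
    and bracket_closed: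
      "\<lbrakk>x \<in> lcarrier G; y \<in> lcarrier G\<rbrakk> \<Longrightarrow> bracket G x y \<in> lcarrier G"
    and bracket_add_left:
      "\<lbrakk>x \<in> lcarrier G; y \<in> lcarrier G; z \<in> lcarrier G\<rbrakk>
        \<Longrightarrow> bracket G (x + y) z = bracket G x z + bracket G y z"
    and bracket_add_right:
      "\<lbrakk>x \<in> lcarrier G; y \<in> lcarrier G; z \<in> lcarrier G\<rbrakk>
        \<Longrightarrow> bracket G x (y + z) = bracket G x y + bracket G x z"
    and bracket_scale_left:
      "\<lbrakk>x \<in> lcarrier G; y \<in> lcarrier G\<rbrakk>
        \<Longrightarrow> bracket G (lscale G c x) y = lscale G c (bracket G x y)"
    and bracket_scale_right:
      "\<lbrakk>x \<in> lcarrier G; y \<in> lcarrier G\<rbrakk>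
        \<Longrightarrow> bracket G x (lscale G c y) = lscale G c (bracket G x y)"
    and leibniz_identity:
      "\<lbrakk>x \<in> lcarrier G; y \<in> lcarrier G; z \<in> lcarrier G\<rbrakk>
        \<Longrightarrow> bracket G x (bracket G y z) =
            bracket G (bracket G x y) z - bracket G (bracket G x z) y"

definition leibniz_hom ::
  "('k::field, 'a::ab_group_add) leibniz \<Rightarrow> ('k, 'b::ab_group_add) leibniz \<Rightarrow> ('a \<Rightarrow> 'b) \<Rightarrow> bool"
where
  "leibniz_hom G H f \<longleftrightarrow>
     f ` lcarrier G \<subseteq> lcarrier H \<and>
     (\<forall>x\<in>lcarrier G. \<forall>y\<in>lcarrier G. f (x + y) = f x + f y) \<and>
     (\<forall>c. \<forall>x\<in>lcarrier G. f (lscale G c x) = lscale H c (f x)) \<and>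
     (\<forall>x\<in>lcarrier G. \<forall>y\<in>lcarrier G. f (bracket G x y) = bracket H (f x) (f y))"

definition leibniz_iso ::
  "('k::field, 'a::ab_group_add) leibniz \<Rightarrow> ('k, 'b::ab_group_add) leibniz \<Rightarrow> ('a \<Rightarrow> 'b) \<Rightarrow> bool"
where
  "leibniz_iso G H f \<longleftrightarrow> leibniz_hom G H f \<and> bij_betw f (lcarrier G) (lcarrier H)"

definition leibniz_ideal :: "('k::field, 'a::ab_group_add) leibniz \<Rightarrow> 'a set \<Rightarrow> bool" where
  "leibniz_ideal G I \<longleftrightarrow>
     module.subspace (lscale G) I \<and> I \<subseteq> lcarrier G \<and>
     (\<forall>x\<in>lcarrier G. \<forall>i\<in>I. bracket G x i \<in> I \<and> bracket G i x \<in> I)"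

definition lie_commutator ::
  "('k::field, 'a::ab_group_add) leibniz \<Rightarrow> 'a set \<Rightarrow> 'a set \<Rightarrow> 'a set" where
  "lie_commutator G M N =
     leibniz_ideal G hull {bracket G m n + bracket G n m | m n. m \<in> M \<and> n \<in> N}"

text \<open>The ideal $[\mathfrak g,\mathfrak g]_{\mathsf{Lie}}$ as a Leibniz algebra in its own right.\<close>

definition lie_commutator_algebra ::
  "('k::field, 'a::ab_group_add) leibniz \<Rightarrow> ('k, 'a) leibniz" where
  "lie_commutator_algebra G = G\<lparr>lcarrier := lie_commutator G (lcarrier G) (lcarrier G)\<rparr>"

definition lie_center :: "('k::field, 'a::ab_group_add) leibniz \<Rightarrow> 'a set" where
  "lie_center G =
     {z \<in> lcarrier G. \<forall>x\<in>lcarrier G. bracket G x z + bracket G z x = 0}"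

record ('k, 'n, 'g, 'q) leibniz_ext =
  ext_ker :: "('k, 'n) leibniz"
  ext_mid :: "('k, 'g) leibniz"
  ext_quo :: "('k, 'q) leibniz"
  ext_inc :: "'n \<Rightarrow> 'g"
  ext_proj :: "'g \<Rightarrow> 'q"

definition leibniz_extension ::
  "('k::field, 'n::ab_group_add, 'g::ab_group_add, 'q::ab_group_add) leibniz_ext \<Rightarrow> bool"
where
  "leibniz_extension E \<longleftrightarrow>
     leibniz_algebra (ext_ker E) \<and> leibniz_algebra (ext_mid E) \<and> leibniz_algebra (ext_quo E) \<and>
     leibniz_hom (ext_ker E) (ext_mid E) (ext_inc E) \<and>
     leibniz_hom (ext_mid E) (ext_quo E) (ext_proj E) \<and>
     inj_on (ext_inc E) (lcarrier (ext_ker E)) \<and>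
     ext_inc E ` lcarrier (ext_ker E) = {x \<in> lcarrier (ext_mid E). ext_proj E x = 0} \<and>
     ext_proj E ` lcarrier (ext_mid E) = lcarrier (ext_quo E)"

definition lie_central_extension ::
  "('k::field, 'n::ab_group_add, 'g::ab_group_add, 'q::ab_group_add) leibniz_ext \<Rightarrow> bool"
where
  "lie_central_extension E \<longleftrightarrow>
     leibniz_extension E \<and> ext_inc E ` lcarrier (ext_ker E) \<subseteq> lie_center (ext_mid E)"

text \<open>
  The map $C$. For a $\mathsf{Lie}$-central extension the description determines a unique
  value, see \<open>lie_commutator_map_eq\<close> below.
\<close>

definition lie_commutator_map ::
  "('k::field, 'n::ab_group_add, 'g::ab_group_add, 'q::ab_group_add) leibniz_ext
     \<Rightarrow> 'q \<Rightarrow> 'q \<Rightarrow> 'g"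
where
  "lie_commutator_map E a b =
     (THE c. \<exists>x\<in>lcarrier (ext_mid E). \<exists>y\<in>lcarrier (ext_mid E).
        ext_proj E x = a \<and> ext_proj E y = b \<and>
        c = bracket (ext_mid E) x y + bracket (ext_mid E) y x)"

definition lie_isoclinism ::
  "('k::field, 'n1::ab_group_add, 'g1::ab_group_add, 'q1::ab_group_add) leibniz_ext \<Rightarrow>
   ('k, 'n2::ab_group_add, 'g2::ab_group_add, 'q2::ab_group_add) leibniz_ext \<Rightarrow>
   ('q1 \<Rightarrow> 'q2) \<Rightarrow> ('g1 \<Rightarrow> 'g2) \<Rightarrow> bool"
where
  "lie_isoclinism E1 E2 \<eta> \<xi> \<longleftrightarrow>
     leibniz_iso (ext_quo E1) (ext_quo E2) \<eta> \<and>
     leibniz_iso (lie_commutator_algebra (ext_mid E1)) (lie_commutator_algebra (ext_mid E2)) \<xi> \<and>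
     (\<forall>a\<in>lcarrier (ext_quo E1). \<forall>b\<in>lcarrier (ext_quo E1).
        \<xi> (lie_commutator_map E1 a b) = lie_commutator_map E2 (\<eta> a) (\<eta> b))"

definition lie_isoclinic ::
  "('k::field, 'n1::ab_group_add, 'g1::ab_group_add, 'q1::ab_group_add) leibniz_ext \<Rightarrow>
   ('k, 'n2::ab_group_add, 'g2::ab_group_add, 'q2::ab_group_add) leibniz_ext \<Rightarrow> bool"
where
  "lie_isoclinic E1 E2 \<longleftrightarrow> (\<exists>\<eta> \<xi>. lie_isoclinism E1 E2 \<eta> \<xi>)"

definition ext_hom ::
  "('k::field, 'n1::ab_group_add, 'g1::ab_group_add, 'q1::ab_group_add) leibniz_ext \<Rightarrow>
   ('k, 'n2::ab_group_add, 'g2::ab_group_add, 'q2::ab_group_add) leibniz_ext \<Rightarrow>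
   ('n1 \<Rightarrow> 'n2) \<Rightarrow> ('g1 \<Rightarrow> 'g2) \<Rightarrow> ('q1 \<Rightarrow> 'q2) \<Rightarrow> bool"
where
  "ext_hom E1 E2 \<alpha> \<beta> \<gamma> \<longleftrightarrow>
     leibniz_hom (ext_ker E1) (ext_ker E2) \<alpha> \<and>
     leibniz_hom (ext_mid E1) (ext_mid E2) \<beta> \<and>
     leibniz_hom (ext_quo E1) (ext_quo E2) \<gamma> \<and>
     (\<forall>n\<in>lcarrier (ext_ker E1). ext_inc E2 (\<alpha> n) = \<beta> (ext_inc E1 n)) \<and>
     (\<forall>x\<in>lcarrier (ext_mid E1). ext_proj E2 (\<beta> x) = \<gamma> (ext_proj E1 x))"

definition lie_isoclinic_hom ::
  "('k::field, 'n1::ab_group_add, 'g1::ab_group_add, 'q1::ab_group_add) leibniz_ext \<Rightarrow>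
   ('k, 'n2::ab_group_add, 'g2::ab_group_add, 'q2::ab_group_add) leibniz_ext \<Rightarrow>
   ('n1 \<Rightarrow> 'n2) \<Rightarrow> ('g1 \<Rightarrow> 'g2) \<Rightarrow> ('q1 \<Rightarrow> 'q2) \<Rightarrow> bool"
where
  "lie_isoclinic_hom E1 E2 \<alpha> \<beta> \<gamma> \<longleftrightarrow>
     ext_hom E1 E2 \<alpha> \<beta> \<gamma> \<and> (\<exists>\<beta>'. lie_isoclinism E1 E2 \<gamma> \<beta>')"

definition lie_isoclinic_epi ::
  "('k::field, 'n1::ab_group_add, 'g1::ab_group_add, 'q1::ab_group_add) leibniz_ext \<Rightarrow>
   ('k, 'n2::ab_group_add, 'g2::ab_group_add, 'q2::ab_group_add) leibniz_ext \<Rightarrow>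
   ('n1 \<Rightarrow> 'n2) \<Rightarrow> ('g1 \<Rightarrow> 'g2) \<Rightarrow> ('q1 \<Rightarrow> 'q2) \<Rightarrow> bool"
where
  "lie_isoclinic_epi E1 E2 \<alpha> \<beta> \<gamma> \<longleftrightarrow>
     lie_isoclinic_hom E1 E2 \<alpha> \<beta> \<gamma> \<and> \<beta> ` lcarrier (ext_mid E1) = lcarrier (ext_mid E2)"

definition lie_isoclinic_mono ::
  "('k::field, 'n1::ab_group_add, 'g1::ab_group_add, 'q1::ab_group_add) leibniz_ext \<Rightarrow>
   ('k, 'n2::ab_group_add, 'g2::ab_group_add, 'q2::ab_group_add) leibniz_ext \<Rightarrow>
   ('n1 \<Rightarrow> 'n2) \<Rightarrow> ('g1 \<Rightarrow> 'g2) \<Rightarrow> ('q1 \<Rightarrow> 'q2) \<Rightarrow> bool"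
where
  "lie_isoclinic_mono E1 E2 \<alpha> \<beta> \<gamma> \<longleftrightarrow>
     lie_isoclinic_hom E1 E2 \<alpha> \<beta> \<gamma> \<and> inj_on \<beta> (lcarrier (ext_mid E1))"

definition isoclinic_epis_onto ::
  "('k::field, 'n::ab_group_add, 'g::ab_group_add, 'q::ab_group_add) leibniz_ext \<Rightarrow>
   ('k, 'n1::ab_group_add, 'g1::ab_group_add, 'q1::ab_group_add) leibniz_ext \<Rightarrow>
   ('k, 'n2::ab_group_add, 'g2::ab_group_add, 'q2::ab_group_add) leibniz_ext \<Rightarrow> bool"
where
  "isoclinic_epis_onto E E1 E2 \<longleftrightarrow>
     lie_central_extension E \<and>
     (\<exists>\<alpha> \<beta> \<gamma>. lie_isoclinic_epi E E1 \<alpha> \<beta> \<gamma>) \<and>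
     (\<exists>\<alpha> \<beta> \<gamma>. lie_isoclinic_epi E E2 \<alpha> \<beta> \<gamma>)"

definition isoclinic_monos_into ::
  "('k::field, 'n::ab_group_add, 'g::ab_group_add, 'q::ab_group_add) leibniz_ext \<Rightarrow>
   ('k, 'n1::ab_group_add, 'g1::ab_group_add, 'q1::ab_group_add) leibniz_ext \<Rightarrow>
   ('k, 'n2::ab_group_add, 'g2::ab_group_add, 'q2::ab_group_add) leibniz_ext \<Rightarrow> bool"
where
  "isoclinic_monos_into E E1 E2 \<longleftrightarrow>
     lie_central_extension E \<and>
     (\<exists>\<alpha> \<beta> \<gamma>. lie_isoclinic_mono E1 E \<alpha> \<beta> \<gamma>) \<and>
     (\<exists>\<alpha> \<beta> \<gamma>. lie_isoclinic_mono E2 E \<alpha> \<beta> \<gamma>)"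

lemma lie_central_bracket_shift:
  assumes E: "lie_central_extension E"
    and x: "x \<in> lcarrier (ext_mid E)" and x': "x' \<in> lcarrier (ext_mid E)"
    and y: "y \<in> lcarrier (ext_mid E)" and eq: "ext_proj E x = ext_proj E x'"
  shows "bracket (ext_mid E) x y + bracket (ext_mid E) y x =
         bracket (ext_mid E) x' y + bracket (ext_mid E) y x'"
proof -
  let ?G = "ext_mid E"
  interpret leibniz_algebra ?G
    using E by (simp add: lie_central_extension_def leibniz_extension_def)
  have d: "x - x' \<in> lcarrier ?G" using x x' subspace_carrier by (rule_tac subspace_diff)
  have add: "\<And>u v. u \<in> lcarrier ?G \<Longrightarrow> v \<in> lcarrier ?G \<Longrightarrow>
      ext_proj E (u + v) = ext_proj E u + ext_proj E v"
    using E by (simp add: lie_central_extension_def leibniz_extension_def leibniz_hom_def)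
  have "ext_proj E x = ext_proj E x' + ext_proj E (x - x')" using add[OF x' d] by simp
  then have "ext_proj E (x - x') = 0" using eq by simp
  then have "x - x' \<in> lie_center ?G"
    using E d unfolding lie_central_extension_def leibniz_extension_def by blast
  then have z: "bracket ?G y (x - x') + bracket ?G (x - x') y = 0"
    using y by (simp add: lie_center_def)
  have "bracket ?G x y = bracket ?G x' y + bracket ?G (x - x') y"
    using bracket_add_left[OF x' d y] by simp
  moreover have "bracket ?G y x = bracket ?G y x' + bracket ?G y (x - x')"
    using bracket_add_right[OF y x' d] by simp
  ultimately show ?thesis using z by (simp add: algebra_simps)
qed

lemma lie_commutator_map_eq:
  assumes E: "lie_central_extension E"
    and x: "x \<in> lcarrier (ext_mid E)" and y: "y \<in> lcarrier (ext_mid E)"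
  shows "lie_commutator_map E (ext_proj E x) (ext_proj E y) =
         bracket (ext_mid E) x y + bracket (ext_mid E) y x"
  unfolding lie_commutator_map_def
proof (rule the_equality)
  fix c
  assume "\<exists>x'\<in>lcarrier (ext_mid E). \<exists>y'\<in>lcarrier (ext_mid E).
    ext_proj E x' = ext_proj E x \<and> ext_proj E y' = ext_proj E y \<and>
    c = bracket (ext_mid E) x' y' + bracket (ext_mid E) y' x'"
  then obtain x' y' where *: "x' \<in> lcarrier (ext_mid E)" "y' \<in> lcarrier (ext_mid E)"
    "ext_proj E x' = ext_proj E x" "ext_proj E y' = ext_proj E y"
    "c = bracket (ext_mid E) x' y' + bracket (ext_mid E) y' x'" by blast
  show "c = bracket (ext_mid E) x y + bracket (ext_mid E) y x"
    using lie_central_bracket_shift[OF E *(1) x *(2,3)]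
      lie_central_bracket_shift[OF E *(2) y x *(4)] *(5)
    by (simp add: add.commute)
qed (use x y in blast)

end

theory Submission
  imports Defs
begin

text \<open>
  For \<open>(a) \<Longrightarrow> (b)\<close> take the fibre product of \<open>g1\<close> and \<open>g2\<close> over the common quotient; its commutator
  ideal is the graph of \<open>\<xi>\<close>, because commutator ideals are spanned by commutator values. The converse
  directions hold because isoclinism is symmetric and transitive.

  For \<open>(a) \<Longrightarrow> (c)\<close> let \<open>N2\<close> be the kernel of \<open>g2 \<rightarrow> q\<close>. It is an ideal both of \<open>D = g1 \<times>\<^sub>q g2\<close>, as
  \<open>(0, n)\<close>, and of \<open>B = g2 \<times>\<^sub>q g2\<close>, as \<open>(n, 0)\<close>, and it meets neither commutator ideal. So the Lie
  quotients of \<open>D\<close> and \<open>B\<close> embed in a Lie algebra \<open>Y\<close>, their amalgam over \<open>N2\<close>. Write \<open>\<nu> n\<close> for the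
  image of \<open>n\<close> in \<open>Y\<close>. The pairs \<open>(u, x)\<close> in \<open>Y \<times> g2\<close> for which \<open>u\<close> acts on \<open>\<nu> N2\<close> as \<open>x\<close> acts on \<open>N2\<close>
  form a Leibniz algebra with ideal \<open>{(\<nu> n, n)}\<close>, and the quotient by it contains \<open>g2\<close> via
  \<open>x \<mapsto> ((x, x), x)\<close> and \<open>g1\<close> via \<open>x1 \<mapsto> ((x1, x2), x2)\<close> for any \<open>x2\<close> over the same point of \<open>q\<close>.
  The first component of \<open>Y \<times> g2\<close> is a Lie algebra, so only \<open>g2\<close> contributes commutators.
\<close>

section \<open>Commutator ideals and isoclinism\<close>

text \<open>The obstacle in (c) is that \<open>N2\<close> is only Lie-central: it can be nonabelian,
  it can act nontrivially on \<open>g2\<close>, and it can meet the commutator ideal of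
  \<open>g2\<close>, so that the Lie quotient of \<open>g2\<close> may lose part of it. Doubling
  \<open>g2\<close> to \<open>B\<close> cures the last point: commutators of \<open>B\<close> lie on
  the diagonal and those of \<open>D\<close> on the graph of \<xi>, so an element (n, 0),
  respectively (0, n), of the commutator ideal is 0. Because of the other two points the Lie
  quotients have to be glued along a possibly noncentral subalgebra, and the danger is that the
  glued algebra collapses. That it does not is shown in the style of Poincare-Birkhoff-Witt and the
  diamond lemma: words in basis vectors are rewritten by xy = yx + [x,y]. Division by 2 enters
  because [x,x] is half of [x,x] + [x,x], so that the bracket modulo the commutator ideal is
  alternating. A last constraint comes from the type system: the type of the common extension has to
  depend on the given types alone, whence the copy of the generated subalgebra inside functions on
  words.\<close>

definition lie_sym :: "('k::field, 'a::ab_group_add) leibniz \<Rightarrow> 'a \<Rightarrow> 'a \<Rightarrow> 'a" where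
  "lie_sym G x y = bracket G x y + bracket G y x"

abbreviation lie_derived :: "('k::field, 'a::ab_group_add) leibniz \<Rightarrow> 'a set" where
  "lie_derived G \<equiv> lie_commutator G (lcarrier G) (lcarrier G)"

context leibniz_algebra
begin

lemma carrier_zero [simp]: "0 \<in> lcarrier G"
  and carrier_add: "x \<in> lcarrier G \<Longrightarrow> y \<in> lcarrier G \<Longrightarrow> x + y \<in> lcarrier G"
  and carrier_diff: "x \<in> lcarrier G \<Longrightarrow> y \<in> lcarrier G \<Longrightarrow> x - y \<in> lcarrier G"
  and carrier_neg: "x \<in> lcarrier G \<Longrightarrow> - x \<in> lcarrier G"
  and carrier_scale: "x \<in> lcarrier G \<Longrightarrow> lscale G c x \<in> lcarrier G"
  using subspace_carrier by (auto intro: subspace_0 subspace_add subspace_diff subspace_neg subspace_scale)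

lemmas carrier_closed = carrier_add carrier_diff carrier_neg carrier_scale bracket_closed

lemma bracket_zero_left [simp]: "x \<in> lcarrier G \<Longrightarrow> bracket G 0 x = 0"
  using bracket_add_left[of 0 0 x] by simp

lemma bracket_zero_right [simp]: "x \<in> lcarrier G \<Longrightarrow> bracket G x 0 = 0"
  using bracket_add_right[of x 0 0] by simp

lemma bracket_diff_left:
  assumes "x \<in> lcarrier G" "y \<in> lcarrier G" "z \<in> lcarrier G"
  shows "bracket G (x - y) z = bracket G x z - bracket G y z"
  using bracket_add_left[of "x - y" y z] assms by (simp add: carrier_diff algebra_simps)

lemma bracket_diff_right:
  assumes "x \<in> lcarrier G" "y \<in> lcarrier G" "z \<in> lcarrier G"
  shows "bracket G x (y - z) = bracket G x y - bracket G x z"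
  using bracket_add_right[of x "y - z" z] assms by (simp add: carrier_diff algebra_simps)

lemma lie_sym_closed: "x \<in> lcarrier G \<Longrightarrow> y \<in> lcarrier G \<Longrightarrow> lie_sym G x y \<in> lcarrier G"
  by (simp add: lie_sym_def carrier_closed)

text \<open>The Leibniz identity expands [z,[x,y]] into a difference that changes sign when x and y
  are exchanged, so the expansions of the two summands cancel.\<close>

lemma bracket_lie_sym:
  assumes "x \<in> lcarrier G" "y \<in> lcarrier G" "z \<in> lcarrier G"
  shows "bracket G z (lie_sym G x y) = 0"
  using assms by (simp add: lie_sym_def bracket_add_right bracket_closed leibniz_identity)

lemma lie_sym_bracket:
  assumes "x \<in> lcarrier G" "y \<in> lcarrier G" "z \<in> lcarrier G"
  shows "bracket G (lie_sym G x y) z = lie_sym G (bracket G x z) y + lie_sym G x (bracket G y z)"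
  using assms by (simp add: lie_sym_def bracket_add_left bracket_closed leibniz_identity)

text \<open>Left brackets kill commutators, and right bracketing is a derivation, so it turns a
  commutator into a sum of two commutators. The linear span is therefore already an ideal.\<close>

lemma lie_derived_eq_span:
  "lie_derived G = span {lie_sym G x y | x y. x \<in> lcarrier G \<and> y \<in> lcarrier G}"
    (is "_ = span ?S")
proof -
  have sub: "span ?S \<subseteq> lcarrier G"
    by (rule span_minimal) (auto simp: subspace_carrier lie_sym_closed)
  have L: "bracket G z s = 0" if z: "z \<in> lcarrier G" and s: "s \<in> span ?S" for z s
  proof -
    have "span ?S \<subseteq> {s \<in> lcarrier G. bracket G z s = 0}"
      by (rule span_minimal) (use z in \<open>auto simp: bracket_lie_sym lie_sym_closed carrier_closed
          bracket_add_right bracket_scale_right intro!: subspaceI\<close>)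
    then show ?thesis using s by auto
  qed
  have R: "bracket G s z \<in> span ?S" if z: "z \<in> lcarrier G" and s: "s \<in> span ?S" for z s
  proof -
    have "bracket G (lie_sym G u v) z \<in> span ?S" if "u \<in> lcarrier G" "v \<in> lcarrier G" for u v
      unfolding lie_sym_bracket[OF that z]
      by (intro span_add span_base) (use that z bracket_closed in blast)+
    then have "span ?S \<subseteq> {s \<in> lcarrier G. bracket G s z \<in> span ?S}"
      by (intro span_minimal) (use z in \<open>auto simp: lie_sym_closed carrier_closed
          bracket_add_left bracket_scale_left span_zero span_add span_scale intro!: subspaceI\<close>)
    then show ?thesis using s by auto
  qed
  have "leibniz_ideal G hull ?S = span ?S"
  proof (rule hull_unique)
    show "leibniz_ideal G (span ?S)"
      unfolding leibniz_ideal_def using sub L R by (auto simp: span_zero)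
    show "span ?S \<subseteq> t" if "?S \<subseteq> t" "leibniz_ideal G t" for t
      by (rule span_minimal) (use that in \<open>auto simp: leibniz_ideal_def\<close>)
  qed (simp add: span_superset)
  then show ?thesis by (simp add: lie_commutator_def lie_sym_def)
qed

lemma lie_sym_in_derived: "x \<in> lcarrier G \<Longrightarrow> y \<in> lcarrier G \<Longrightarrow> lie_sym G x y \<in> lie_derived G"
  unfolding lie_derived_eq_span by (blast intro: span_base)

lemma lie_derived_subspace: "subspace (lie_derived G)"
  by (simp add: lie_derived_eq_span)

lemma lie_derived_minimal:
  assumes "subspace S" and "\<And>x y. x \<in> lcarrier G \<Longrightarrow> y \<in> lcarrier G \<Longrightarrow> lie_sym G x y \<in> S"
  shows "lie_derived G \<subseteq> S"
  unfolding lie_derived_eq_span by (rule span_minimal) (use assms in auto)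

lemma lie_derived_carrier: "lie_derived G \<subseteq> lcarrier G"
  by (rule lie_derived_minimal) (simp_all add: subspace_carrier lie_sym_closed)

lemma lie_derived_induct [consumes 1, case_names zero sym add scale]:
  assumes "l \<in> lie_derived G" and "P 0"
    and "\<And>x y. x \<in> lcarrier G \<Longrightarrow> y \<in> lcarrier G \<Longrightarrow> P (lie_sym G x y)"
    and "\<And>l m. l \<in> lie_derived G \<Longrightarrow> m \<in> lie_derived G \<Longrightarrow> P l \<Longrightarrow> P m \<Longrightarrow> P (l + m)"
    and "\<And>c l. l \<in> lie_derived G \<Longrightarrow> P l \<Longrightarrow> P (lscale G c l)"
  shows "P l"
proof -
  have "subspace {l \<in> lie_derived G. P l}"
    using assms lie_derived_subspace
    by (intro subspaceI) (auto intro: subspace_0 subspace_add subspace_scale)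
  then have "lie_derived G \<subseteq> {l \<in> lie_derived G. P l}"
    by (rule lie_derived_minimal) (use assms lie_sym_in_derived in auto)
  then show ?thesis using assms(1) by auto
qed

lemma bracket_derived_right: "z \<in> lcarrier G \<Longrightarrow> l \<in> lie_derived G \<Longrightarrow> bracket G z l = 0"
  by (rotate_tac, induction l rule: lie_derived_induct)
    (use lie_derived_carrier in \<open>auto simp: bracket_lie_sym bracket_add_right bracket_scale_right subset_iff\<close>)

lemma bracket_derived_left:
  assumes z: "z \<in> lcarrier G" and l: "l \<in> lie_derived G"
  shows "bracket G l z \<in> lie_derived G"
  using l
proof (induction l rule: lie_derived_induct)
  case zero
  then show ?case using z lie_derived_subspace by (simp add: subspace_0)
next
  case (sym x y)
  then show ?case
    using z lie_derived_subspace
    by (auto simp: lie_sym_bracket intro!: subspace_add lie_sym_in_derived bracket_closed)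
next
  case (add l m)
  then show ?case using z lie_derived_subspace lie_derived_carrier
    by (simp add: bracket_add_left subspace_add subset_iff)
next
  case (scale c l)
  then show ?case using z lie_derived_subspace lie_derived_carrier
    by (simp add: bracket_scale_left subspace_scale subset_iff)
qed

text \<open>This is where invertibility of 2 is used: it makes the bracket modulo the commutator
  ideal alternating and not merely skew.\<close>

lemma bracket_self_derived:
  assumes "(2::'k) \<noteq> 0" and x: "x \<in> lcarrier G"
  shows "bracket G x x \<in> lie_derived G"
proof -
  have "lscale G (inverse 2) (lie_sym G x x) = bracket G x x"
  proof -
    have "lie_sym G x x = lscale G 2 (bracket G x x)"
      using scale_left_distrib[of 1 1 "bracket G x x"] by (simp add: lie_sym_def)
    then show ?thesis using assms by simp
  qed
  then show ?thesis using lie_sym_in_derived[OF x x] lie_derived_subspace subspace_scale by metis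
qed

lemma subalgebra:
  assumes "subspace S" "S \<subseteq> lcarrier G" "\<And>x y. x \<in> S \<Longrightarrow> y \<in> S \<Longrightarrow> bracket G x y \<in> S"
  shows "leibniz_algebra (G\<lparr>lcarrier := S\<rparr>)"
proof -
  have "vector_space (lscale (G\<lparr>lcarrier := S\<rparr>))" by (simp, unfold_locales)
  then show ?thesis
    unfolding leibniz_algebra_def leibniz_algebra_axioms_def
    using assms bracket_add_left bracket_add_right bracket_scale_left bracket_scale_right leibniz_identity
    by (simp add: subset_iff)
qed

lemma leibniz_algebra_derived: "leibniz_algebra (lie_commutator_algebra G)"
  unfolding lie_commutator_algebra_def
  by (rule subalgebra) (use lie_derived_subspace lie_derived_carrier bracket_derived_left in auto)

lemma lie_sym_sub: "lie_sym (G\<lparr>lcarrier := S\<rparr>) = lie_sym G"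
  by (simp add: lie_sym_def fun_eq_iff)

end

section \<open>Homomorphisms, Lie-central extensions and isoclinisms\<close>

lemma leibniz_homD:
  assumes "leibniz_hom G H f"
  shows "x \<in> lcarrier G \<Longrightarrow> f x \<in> lcarrier H"
    and "x \<in> lcarrier G \<Longrightarrow> y \<in> lcarrier G \<Longrightarrow> f (x + y) = f x + f y"
    and "x \<in> lcarrier G \<Longrightarrow> f (lscale G c x) = lscale H c (f x)"
    and "x \<in> lcarrier G \<Longrightarrow> y \<in> lcarrier G \<Longrightarrow> f (bracket G x y) = bracket H (f x) (f y)"
  using assms by (auto simp: leibniz_hom_def)

lemma leibniz_homI:
  assumes "\<And>x. x \<in> lcarrier G \<Longrightarrow> f x \<in> lcarrier H"
    and "\<And>x y. x \<in> lcarrier G \<Longrightarrow> y \<in> lcarrier G \<Longrightarrow> f (x + y) = f x + f y"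
    and "\<And>c x. x \<in> lcarrier G \<Longrightarrow> f (lscale G c x) = lscale H c (f x)"
    and "\<And>x y. x \<in> lcarrier G \<Longrightarrow> y \<in> lcarrier G \<Longrightarrow> f (bracket G x y) = bracket H (f x) (f y)"
  shows "leibniz_hom G H f"
  using assms by (auto simp: leibniz_hom_def)

lemma (in leibniz_algebra)
  assumes "leibniz_hom G H f"
  shows hom_zero: "f 0 = 0"
    and hom_diff: "x \<in> lcarrier G \<Longrightarrow> y \<in> lcarrier G \<Longrightarrow> f (x - y) = f x - f y"
    and hom_lie_sym: "x \<in> lcarrier G \<Longrightarrow> y \<in> lcarrier G \<Longrightarrow> f (lie_sym G x y) = lie_sym H (f x) (f y)"
    and hom_inj_on: "(\<And>x. x \<in> lcarrier G \<Longrightarrow> f x = 0 \<Longrightarrow> x = 0) \<Longrightarrow> inj_on f (lcarrier G)"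
proof -
  note h = leibniz_homD[OF assms]
  show z: "f 0 = 0" using h(2)[of 0 0] by simp
  show d: "f (x - y) = f x - f y" if "x \<in> lcarrier G" "y \<in> lcarrier G" for x y
    using h(2)[of "x - y" y] that by (simp add: carrier_diff algebra_simps)
  show "f (lie_sym G x y) = lie_sym H (f x) (f y)" if "x \<in> lcarrier G" "y \<in> lcarrier G"
    using that by (simp add: lie_sym_def h bracket_closed)
  show "inj_on f (lcarrier G)" if *: "\<And>x. x \<in> lcarrier G \<Longrightarrow> f x = 0 \<Longrightarrow> x = 0"
    by (rule inj_onI) (metis * d carrier_diff eq_iff_diff_eq_0)
qed

lemma leibniz_iso_inverse:
  assumes G: "leibniz_algebra G" and f: "leibniz_iso G H f"
  shows "leibniz_iso H G (inv_into (lcarrier G) f)"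
proof -
  interpret leibniz_algebra G by fact
  let ?g = "inv_into (lcarrier G) f"
  have hom: "leibniz_hom G H f" and b: "bij_betw f (lcarrier G) (lcarrier H)"
    using f by (auto simp: leibniz_iso_def)
  note h = leibniz_homD[OF hom]
  have g: "?g y \<in> lcarrier G" "f (?g y) = y" if "y \<in> lcarrier H" for y
    using that b by (auto simp: bij_betw_def inv_into_into f_inv_into_f)
  have gf: "?g (f x) = x" if "x \<in> lcarrier G" for x
    using that b by (simp add: bij_betw_def)
  have "leibniz_hom H G ?g"
  proof (rule leibniz_homI)
    fix x y assume xy: "x \<in> lcarrier H" "y \<in> lcarrier H"
    show "?g (x + y) = ?g x + ?g y"
      using gf[of "?g x + ?g y"] xy by (simp add: g h carrier_add)
    show "?g (bracket H x y) = bracket G (?g x) (?g y)"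
      using gf[of "bracket G (?g x) (?g y)"] xy by (simp add: g h bracket_closed)
  next
    fix c x assume x: "x \<in> lcarrier H"
    show "?g (lscale H c x) = lscale G c (?g x)"
      using gf[of "lscale G c (?g x)"] x by (simp add: g h carrier_scale)
  qed (use g in auto)
  then show ?thesis using b by (simp add: leibniz_iso_def bij_betw_inv_into)
qed

lemma leibniz_iso_compose:
  assumes "leibniz_iso G H f" "leibniz_iso H K g"
  shows "leibniz_iso G K (g \<circ> f)"
  using assms unfolding leibniz_iso_def leibniz_hom_def
  by (auto intro: bij_betw_trans simp: image_subset_iff)

lemma leibniz_iso_id: "leibniz_iso G G (\<lambda>x. x)"
  by (auto simp: leibniz_iso_def leibniz_hom_def bij_betw_def)

lemma lie_central_extensionD:
  assumes "lie_central_extension E"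
  shows "leibniz_algebra (ext_ker E)" "leibniz_algebra (ext_mid E)" "leibniz_algebra (ext_quo E)"
    "leibniz_hom (ext_ker E) (ext_mid E) (ext_inc E)"
    "leibniz_hom (ext_mid E) (ext_quo E) (ext_proj E)"
    "inj_on (ext_inc E) (lcarrier (ext_ker E))"
    "ext_inc E ` lcarrier (ext_ker E) = {x \<in> lcarrier (ext_mid E). ext_proj E x = 0}"
    "ext_proj E ` lcarrier (ext_mid E) = lcarrier (ext_quo E)"
    "x \<in> lcarrier (ext_mid E) \<Longrightarrow> ext_proj E x = 0 \<Longrightarrow> y \<in> lcarrier (ext_mid E)
      \<Longrightarrow> lie_sym (ext_mid E) x y = 0"
proof -
  show "lie_sym (ext_mid E) x y = 0"
    if "x \<in> lcarrier (ext_mid E)" "ext_proj E x = 0" "y \<in> lcarrier (ext_mid E)"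
  proof -
    have "x \<in> lie_center (ext_mid E)"
      using assms that unfolding lie_central_extension_def leibniz_extension_def by blast
    then show ?thesis using that by (simp add: lie_center_def lie_sym_def add.commute[of "bracket _ x y"])
  qed
qed (use assms in \<open>auto simp: lie_central_extension_def leibniz_extension_def\<close>)

lemma lie_central_extensionI:
  assumes "leibniz_algebra (ext_ker E)" "leibniz_algebra (ext_mid E)" "leibniz_algebra (ext_quo E)"
    "leibniz_hom (ext_ker E) (ext_mid E) (ext_inc E)"
    "leibniz_hom (ext_mid E) (ext_quo E) (ext_proj E)"
    "inj_on (ext_inc E) (lcarrier (ext_ker E))"
    "ext_inc E ` lcarrier (ext_ker E) = {x \<in> lcarrier (ext_mid E). ext_proj E x = 0}"
    "ext_proj E ` lcarrier (ext_mid E) = lcarrier (ext_quo E)"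
    "\<And>x y. x \<in> lcarrier (ext_mid E) \<Longrightarrow> ext_proj E x = 0 \<Longrightarrow> y \<in> lcarrier (ext_mid E)
      \<Longrightarrow> lie_sym (ext_mid E) x y = 0"
  shows "lie_central_extension E"
  using assms by (auto simp: lie_central_extension_def leibniz_extension_def lie_center_def
      lie_sym_def add.commute)

lemma lie_commutator_map_proj:
  assumes "lie_central_extension E" "x \<in> lcarrier (ext_mid E)" "y \<in> lcarrier (ext_mid E)"
  shows "lie_commutator_map E (ext_proj E x) (ext_proj E y) = lie_sym (ext_mid E) x y"
  using lie_commutator_map_eq[OF assms] by (simp add: lie_sym_def)

text \<open>\<open>inv_into\<close> undoes \<xi> on the commutator ideal only; that the values of
  the commutator map lie there is what allows an isoclinism to be inverted.\<close>

lemma lie_commutator_map_derived: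
  assumes E: "lie_central_extension E" and a: "a \<in> lcarrier (ext_quo E)" "b \<in> lcarrier (ext_quo E)"
  shows "lie_commutator_map E a b \<in> lie_derived (ext_mid E)"
proof -
  interpret leibniz_algebra "ext_mid E" using lie_central_extensionD[OF E] by auto
  obtain x y where "x \<in> lcarrier (ext_mid E)" "y \<in> lcarrier (ext_mid E)"
    "a = ext_proj E x" "b = ext_proj E y"
    using a lie_central_extensionD(8)[OF E] by (metis imageE)
  then show ?thesis using lie_commutator_map_proj[OF E] lie_sym_in_derived by simp
qed

lemma lie_isoclinism_inverse:
  assumes E1: "lie_central_extension E1" and iso: "lie_isoclinism E1 E2 \<eta> \<xi>"
  shows "lie_isoclinism E2 E1 (inv_into (lcarrier (ext_quo E1)) \<eta>)
    (inv_into (lie_derived (ext_mid E1)) \<xi>)"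
proof -
  interpret G1: leibniz_algebra "ext_mid E1" using lie_central_extensionD[OF E1] by auto
  let ?\<eta> = "inv_into (lcarrier (ext_quo E1)) \<eta>" and ?\<xi> = "inv_into (lie_derived (ext_mid E1)) \<xi>"
  note i = iso[unfolded lie_isoclinism_def]
  have e: "leibniz_iso (ext_quo E2) (ext_quo E1) ?\<eta>"
    using leibniz_iso_inverse[OF lie_central_extensionD(3)[OF E1]] i by blast
  have x: "leibniz_iso (lie_commutator_algebra (ext_mid E2)) (lie_commutator_algebra (ext_mid E1)) ?\<xi>"
    using leibniz_iso_inverse[OF G1.leibniz_algebra_derived, of "lie_commutator_algebra (ext_mid E2)" \<xi>] i
    unfolding lie_commutator_algebra_def by simp
  have "?\<xi> (lie_commutator_map E2 a b) = lie_commutator_map E1 (?\<eta> a) (?\<eta> b)"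
    if ab: "a \<in> lcarrier (ext_quo E2)" "b \<in> lcarrier (ext_quo E2)" for a b
  proof -
    have b: "bij_betw \<eta> (lcarrier (ext_quo E1)) (lcarrier (ext_quo E2))"
      using i by (simp add: leibniz_iso_def)
    have c: "?\<eta> a \<in> lcarrier (ext_quo E1)" "?\<eta> b \<in> lcarrier (ext_quo E1)" "\<eta> (?\<eta> a) = a" "\<eta> (?\<eta> b) = b"
      using ab b by (auto simp: bij_betw_def inv_into_into f_inv_into_f)
    have "inj_on \<xi> (lie_derived (ext_mid E1))"
      using i by (simp add: leibniz_iso_def bij_betw_def lie_commutator_algebra_def)
    moreover have "\<xi> (lie_commutator_map E1 (?\<eta> a) (?\<eta> b)) = lie_commutator_map E2 a b"
      using i c by simp
    ultimately show ?thesis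
      using lie_commutator_map_derived[OF E1 c(1,2)] by (metis inv_into_f_f)
  qed
  then show ?thesis using e x by (simp add: lie_isoclinism_def)
qed

lemma lie_isoclinism_compose:
  assumes "lie_isoclinism E1 E2 \<eta> \<xi>" "lie_isoclinism E2 E3 \<eta>' \<xi>'"
  shows "lie_isoclinism E1 E3 (\<eta>' \<circ> \<eta>) (\<xi>' \<circ> \<xi>)"
proof -
  have "\<eta> a \<in> lcarrier (ext_quo E2)" if "a \<in> lcarrier (ext_quo E1)" for a
    using that assms(1) by (auto simp: lie_isoclinism_def leibniz_iso_def leibniz_hom_def)
  then show ?thesis
    using assms by (auto simp: lie_isoclinism_def intro: leibniz_iso_compose)
qed

lemma isoclinic_if_common_epis:
  assumes "isoclinic_epis_onto E E1 E2"
  shows "lie_isoclinic E1 E2"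
proof -
  have E: "lie_central_extension E" using assms by (simp add: isoclinic_epis_onto_def)
  obtain \<gamma>1 \<xi>1 \<gamma>2 \<xi>2 where "lie_isoclinism E E1 \<gamma>1 \<xi>1" "lie_isoclinism E E2 \<gamma>2 \<xi>2"
    using assms unfolding isoclinic_epis_onto_def lie_isoclinic_epi_def lie_isoclinic_hom_def by (elim conjE exE) (rule that)
  then show ?thesis
    unfolding lie_isoclinic_def by (intro exI) (rule lie_isoclinism_compose[OF lie_isoclinism_inverse[OF E]])
qed

lemma isoclinic_if_common_monos:
  assumes "lie_central_extension E2" "isoclinic_monos_into E E1 E2"
  shows "lie_isoclinic E1 E2"
proof -
  obtain \<gamma>1 \<xi>1 \<gamma>2 \<xi>2 where "lie_isoclinism E1 E \<gamma>1 \<xi>1" "lie_isoclinism E2 E \<gamma>2 \<xi>2"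
    using assms unfolding isoclinic_monos_into_def lie_isoclinic_mono_def lie_isoclinic_hom_def by (elim conjE exE) (rule that)
  then show ?thesis
    unfolding lie_isoclinic_def
    by (intro exI) (rule lie_isoclinism_compose[OF _ lie_isoclinism_inverse[OF assms(1)]])
qed

text \<open>Both commutator ideals are spanned by commutator values, so \<open>\<beta>\<close> itself restricts to
  the required isomorphism.\<close>

lemma lie_isoclinic_homI:
  assumes E1: "lie_central_extension E1" and E2: "lie_central_extension E2"
    and hom: "ext_hom E1 E2 \<alpha> \<beta> \<gamma>"
    and iso: "leibniz_iso (ext_quo E1) (ext_quo E2) \<gamma>"
    and inj: "\<And>l. l \<in> lie_derived (ext_mid E1) \<Longrightarrow> \<beta> l = 0 \<Longrightarrow> l = 0"
  shows "lie_isoclinic_hom E1 E2 \<alpha> \<beta> \<gamma>"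
proof -
  let ?G = "ext_mid E1" and ?H = "ext_mid E2"
  interpret G: leibniz_algebra ?G using lie_central_extensionD[OF E1] by auto
  interpret H: leibniz_algebra ?H using lie_central_extensionD[OF E2] by auto
  have b: "leibniz_hom ?G ?H \<beta>" and p: "\<And>x. x \<in> lcarrier ?G \<Longrightarrow> ext_proj E2 (\<beta> x) = \<gamma> (ext_proj E1 x)"
    using hom by (auto simp: ext_hom_def)
  note h = leibniz_homD[OF b] G.hom_zero[OF b] G.hom_lie_sym[OF b]
  note GD = G.lie_derived_carrier[THEN subsetD]
  have into: "\<beta> l \<in> lie_derived ?H" if "l \<in> lie_derived ?G" for l
    using that
  proof (induction l rule: G.lie_derived_induct)
    case zero
    then show ?case using H.lie_derived_subspace by (simp add: h H.subspace_0)
  next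
    case (sym x y)
    then show ?case by (simp add: h H.lie_sym_in_derived)
  next
    case (add l m)
    then show ?case using H.lie_derived_subspace by (simp add: h H.subspace_add GD)
  next
    case (scale c l)
    then show ?case using H.lie_derived_subspace by (simp add: h H.subspace_scale GD)
  qed
  have "lie_derived ?H \<subseteq> \<beta> ` lie_derived ?G"
  proof (rule H.lie_derived_minimal)
    show "H.subspace (\<beta> ` lie_derived ?G)"
    proof (rule H.subspaceI)
      show "0 \<in> \<beta> ` lie_derived ?G" using G.subspace_0[OF G.lie_derived_subspace] h(5) by force
      show "x + y \<in> \<beta> ` lie_derived ?G" if "x \<in> \<beta> ` lie_derived ?G" "y \<in> \<beta> ` lie_derived ?G" for x y
        using that G.subspace_add[OF G.lie_derived_subspace] by (auto simp: h(2)[symmetric] GD)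
      show "lscale ?H c x \<in> \<beta> ` lie_derived ?G" if "x \<in> \<beta> ` lie_derived ?G" for c x
        using that G.subspace_scale[OF G.lie_derived_subspace] by (auto simp: h(3)[symmetric] GD)
    qed
  next
    fix u v assume uv: "u \<in> lcarrier ?H" "v \<in> lcarrier ?H"
    \<comment> \<open>\<beta> need not be onto, but its image meets every fibre of
      \<open>ext_proj E2\<close>, because \<gamma> and \<open>ext_proj E1\<close> are onto.
      Commutators depend on the fibres only.\<close>
    have "\<exists>x\<in>lcarrier ?G. ext_proj E2 (\<beta> x) = ext_proj E2 w" if w: "w \<in> lcarrier ?H" for w
    proof -
      have "ext_proj E2 w \<in> \<gamma> ` ext_proj E1 ` lcarrier ?G"
        using w iso lie_central_extensionD(8)[OF E1] lie_central_extensionD(8)[OF E2]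
        by (auto simp: leibniz_iso_def bij_betw_def)
      then show ?thesis using p by auto
    qed
    then obtain x y where xy: "x \<in> lcarrier ?G" "y \<in> lcarrier ?G" "ext_proj E2 (\<beta> x) = ext_proj E2 u"
      "ext_proj E2 (\<beta> y) = ext_proj E2 v" using uv by metis
    have "lie_sym ?H u v = \<beta> (lie_sym ?G x y)"
      using lie_commutator_map_proj[OF E2, of u v] lie_commutator_map_proj[OF E2, of "\<beta> x" "\<beta> y"] uv xy
      by (simp add: h)
    then show "lie_sym ?H u v \<in> \<beta> ` lie_derived ?G" using G.lie_sym_in_derived xy by auto
  qed
  then have im: "\<beta> ` lie_derived ?G = lie_derived ?H" using into by blast
  have i: "inj_on \<beta> (lie_derived ?G)"
  proof (rule inj_onI)
    fix l m assume lm: "l \<in> lie_derived ?G" "m \<in> lie_derived ?G" "\<beta> l = \<beta> m"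
    then have "\<beta> (l - m) = 0" using G.hom_diff[OF b] by (simp add: GD)
    then show "l = m" using inj[of "l - m"] lm G.subspace_diff[OF G.lie_derived_subspace] by simp
  qed
  have "lie_isoclinism E1 E2 \<gamma> \<beta>"
    unfolding lie_isoclinism_def
  proof (intro conjI ballI iso)
    show "leibniz_iso (lie_commutator_algebra ?G) (lie_commutator_algebra ?H) \<beta>"
      unfolding leibniz_iso_def bij_betw_def
      using im i h GD into by (auto simp: lie_commutator_algebra_def intro!: leibniz_homI)
  next
    fix a b assume "a \<in> lcarrier (ext_quo E1)" "b \<in> lcarrier (ext_quo E1)"
    then obtain x y where xy: "x \<in> lcarrier ?G" "y \<in> lcarrier ?G" "a = ext_proj E1 x" "b = ext_proj E1 y"
      using lie_central_extensionD(8)[OF E1] by (metis imageE)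
    then show "\<beta> (lie_commutator_map E1 a b) = lie_commutator_map E2 (\<gamma> a) (\<gamma> b)"
      using lie_commutator_map_proj[OF E1] lie_commutator_map_proj[OF E2, of "\<beta> x" "\<beta> y"]
      by (simp add: h p)
  qed
  then show ?thesis using hom by (auto simp: lie_isoclinic_hom_def)
qed

section \<open>Rewriting of words in an amalgam\<close>

text \<open>Letters stand for basis vectors of several Lie algebras, the \<open>sides\<close>, glued
  along common letters, and \<open>\<gamma> x y\<close> lists the coordinates of [x,y] when x and y
  share a side. No bracket is prescribed across sides, so every critical pair has to lie within one
  side: this is \<open>overlap\<close>, and \<open>jacobi\<close> resolves the pair there.\<close>

locale lie_rewriting =
  fixes sides :: "'b set set" and lt :: "'b \<Rightarrow> 'b \<Rightarrow> bool"
    and \<gamma> :: "'b \<Rightarrow> 'b \<Rightarrow> 'b \<Rightarrow> 'k::field"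
  assumes lt_irrefl: "\<not> lt x x" and lt_trans: "lt x y \<Longrightarrow> lt y z \<Longrightarrow> lt x z"
    and lt_total: "x \<noteq> y \<Longrightarrow> lt x y \<or> lt y x"
    and finite_supp: "finite {c. \<gamma> x y c \<noteq> 0}"
    and anti: "\<gamma> x y c = - \<gamma> y x c"
    and alt: "\<gamma> x x c = 0"
    and closed: "S \<in> sides \<Longrightarrow> x \<in> S \<Longrightarrow> y \<in> S \<Longrightarrow> \<gamma> x y c \<noteq> 0 \<Longrightarrow> c \<in> S"
    and overlap: "lt z y \<Longrightarrow> lt y x \<Longrightarrow> S \<in> sides \<Longrightarrow> x \<in> S \<Longrightarrow> y \<in> S \<Longrightarrow>
      S' \<in> sides \<Longrightarrow> y \<in> S' \<Longrightarrow> z \<in> S' \<Longrightarrow> \<exists>T\<in>sides. x \<in> T \<and> y \<in> T \<and> z \<in> T"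
    and jacobi: "S \<in> sides \<Longrightarrow> x \<in> S \<Longrightarrow> y \<in> S \<Longrightarrow> z \<in> S \<Longrightarrow>
      (\<Sum>c | \<gamma> y z c \<noteq> 0. \<gamma> y z c * \<gamma> c x e) - (\<Sum>c | \<gamma> x z c \<noteq> 0. \<gamma> x z c * \<gamma> c y e)
        + (\<Sum>c | \<gamma> x y c \<noteq> 0. \<gamma> x y c * \<gamma> c z e) = 0"
begin

definition compat :: "'b \<Rightarrow> 'b \<Rightarrow> bool" where
  "compat x y \<longleftrightarrow> (\<exists>S\<in>sides. x \<in> S \<and> y \<in> S)"

definition subst_sum :: "('b list \<Rightarrow> 'k) \<Rightarrow> 'b list \<Rightarrow> ('b \<Rightarrow> 'k) \<Rightarrow> 'b list \<Rightarrow> 'k" where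
  "subst_sum f a v b = (\<Sum>c | v c \<noteq> 0. v c * f (a @ c # b))"

text \<open>A function on words is a linear functional on the tensor algebra. The admissible ones
  vanish on the relations xy - yx - [x,y], so they form the dual of the enveloping algebra of the
  amalgam, which itself is never constructed.\<close>

definition admissible :: "('b list \<Rightarrow> 'k) set" where
  "admissible = {f. \<forall>a x y b. compat x y \<longrightarrow>
     f (a @ x # y # b) = f (a @ y # x # b) + subst_sum f a (\<gamma> x y) b}"

definition redex :: "'b list \<Rightarrow> 'b list \<times> 'b \<times> 'b \<times> 'b list \<Rightarrow> bool" where
  "redex w = (\<lambda>(a, x, y, b). w = a @ x # y # b \<and> lt y x \<and> compat x y)"

fun inversions :: "'b list \<Rightarrow> nat" where
  "inversions [] = 0"
| "inversions (x # w) = length (filter (\<lambda>y. lt y x) w) + inversions w"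

text \<open>A contraction either exchanges two neighbours, which keeps the length and removes
  exactly one inversion, or replaces two letters by one, which shortens the word.\<close>

definition smaller :: "('b list \<times> 'b list) set" where
  "smaller = inv_image (less_than <*lex*> less_than) (\<lambda>w. (length w, inversions w))"

lemma wf_smaller: "wf smaller"
  by (simp add: smaller_def wf_lex_prod)

lemma inversions_swap: "lt y x \<Longrightarrow> inversions (a @ x # y # b) = Suc (inversions (a @ y # x # b))"
  by (induction a) (auto simp: lt_irrefl dest: lt_trans)

lemma smaller_swap: "lt y x \<Longrightarrow> (a @ y # x # b, a @ x # y # b) \<in> smaller"
  by (simp add: smaller_def inversions_swap)

lemma smaller_length: "length u < length w \<Longrightarrow> (u, w) \<in> smaller"
  by (simp add: smaller_def)

lemma smaller_trans: "(u, v) \<in> smaller \<Longrightarrow> (v, w) \<in> smaller \<Longrightarrow> (u, w) \<in> smaller"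
  by (auto simp: smaller_def)

lemma subst_sum_superset:
  "finite F \<Longrightarrow> {c. v c \<noteq> 0} \<subseteq> F \<Longrightarrow> subst_sum f a v b = (\<Sum>c\<in>F. v c * f (a @ c # b))"
  unfolding subst_sum_def by (rule sum.mono_neutral_left) auto

text \<open>Evaluates \<open>f\<close> on the normal form of a word: redexes picked by
  \<open>SOME\<close> are contracted until none is left, and only the values of \<open>f\<close> on
  irreducible words count.\<close>

function extension :: "('b list \<Rightarrow> 'k) \<Rightarrow> 'b list \<Rightarrow> 'k" where
  "extension f w = (if \<exists>r. redex w r then
      case SOME r. redex w r of (a, x, y, b) \<Rightarrow>
        extension f (a @ y # x # b) + (\<Sum>c | \<gamma> x y c \<noteq> 0. \<gamma> x y c * extension f (a @ c # b))
     else f w)"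
  by auto
termination
proof (relation "inv_image smaller snd")
  have "w = a @ x # y # b \<and> lt y x"
    if "\<exists>r. redex w r" "(a, x, y, b) = (SOME r. redex w r)" for w a x y b
    using someI_ex[OF that(1)] unfolding that(2)[symmetric] by (simp add: redex_def)
  note some_redex = this
  show "((f, a @ y # x # b), f, w) \<in> inv_image smaller snd"
    if "\<exists>r. redex w r" "(a, q) = (SOME r. redex w r)" "(x, r) = q" "(y, b) = r" for f w a q x r y b
    using that some_redex[of w a x y b] smaller_swap by auto
  show "((f, a @ c # b), f, w) \<in> inv_image smaller snd"
    if "\<exists>r. redex w r" "(a, q) = (SOME r. redex w r)" "(x, r) = q" "(y, b) = r"
      "c \<in> {c. \<gamma> x y c \<noteq> 0}" for f w a q x r y b c
    using that some_redex[of w a x y b] smaller_length by auto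
qed (simp add: wf_smaller)

declare extension.simps [simp del]

lemma extension_normal: "\<nexists>r. redex w r \<Longrightarrow> extension f w = f w"
  by (subst extension.simps) simp

definition contract :: "('b list \<Rightarrow> 'k) \<Rightarrow> 'b list \<times> 'b \<times> 'b \<times> 'b list \<Rightarrow> 'k" where
  "contract f = (\<lambda>(a, x, y, b). f (a @ y # x # b) + subst_sum f a (\<gamma> x y) b)"

lemma extension_redex:
  assumes "redex w r"
  obtains r' where "redex w r'" "extension f w = contract (extension f) r'"
proof
  show "redex w (SOME r. redex w r)" using assms by (rule someI)
  show "extension f w = contract (extension f) (SOME r. redex w r)"
    unfolding extension.simps[of f w] if_P[OF exI[of "redex w", OF assms]]
    by (simp add: contract_def subst_sum_def split: prod.splits)
qed

text \<open>Redexes are oriented, the relation is not: for letters in increasing order it is the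
  reversed relation combined with skewness of \<gamma>, and for equal letters it is
  \<open>alt\<close>.\<close>

lemma swap_any_order:
  assumes "\<And>a x y b. u = a @ x # y # b \<or> u = a @ y # x # b \<Longrightarrow> lt y x \<Longrightarrow> compat x y \<Longrightarrow>
      f (a @ x # y # b) = f (a @ y # x # b) + subst_sum f a (\<gamma> x y) b"
    and u: "u = a @ x # y # b" and K: "compat x y"
  shows "f (a @ x # y # b) = f (a @ y # x # b) + subst_sum f a (\<gamma> x y) b"
proof -
  consider "lt y x" | "x = y" | "lt x y" using lt_total by blast
  then show ?thesis
  proof cases
    case 1
    then show ?thesis using assms(1) u K by blast
  next
    case 2
    then show ?thesis by (simp add: subst_sum_def alt)
  next
    case 3
    have "f (a @ y # x # b) = f (a @ x # y # b) + subst_sum f a (\<gamma> y x) b"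
      using assms(1)[of a y x b] 3 u K by (auto simp: compat_def)
    moreover have "subst_sum f a (\<gamma> y x) b = - subst_sum f a (\<gamma> x y) b"
      unfolding subst_sum_def using anti[of y x] by (simp add: sum_negf)
    ultimately show ?thesis by simp
  qed
qed

lemma subst_sum_commute:
  "(\<Sum>c | u c \<noteq> 0. u c * subst_sum f (a @ c # b) v d) = (\<Sum>c | v c \<noteq> 0. v c * subst_sum f a u (b @ c # d))"
  unfolding subst_sum_def sum_distrib_left
  by (rule trans[OF sum.swap]) (simp add: mult.left_commute)

text \<open>Both sides expand into the word with both pairs swapped, the two terms with one swap and
  one substitution, and the double substitution, for which \<open>subst_sum_commute\<close> makes
  the order irrelevant.\<close>

lemma contract_disjoint:
  assumes IH: "\<And>u a x y b. (u, w) \<in> smaller \<Longrightarrow> u = a @ x # y # b \<Longrightarrow> lt y x \<Longrightarrow> compat x y \<Longrightarrow>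
      f u = f (a @ y # x # b) + subst_sum f a (\<gamma> x y) b"
    and w: "w = a @ x # y # b @ u # v # d" and xy: "lt y x" "compat x y" and uv: "lt v u" "compat u v"
  shows "contract f (a, x, y, b @ u # v # d) = contract f (a @ x # y # b, u, v, d)"
proof -
  have s1: "(a @ y # x # b @ u # v # d, w) \<in> smaller"
    using smaller_swap[OF xy(1), of a "b @ u # v # d"] w by simp
  have s2: "(a @ x # y # b @ v # u # d, w) \<in> smaller"
    using smaller_swap[OF uv(1), of "a @ x # y # b" d] w by simp
  have 1: "f (a @ y # x # b @ u # v # d) =
      f (a @ y # x # b @ v # u # d) + subst_sum f (a @ y # x # b) (\<gamma> u v) d"
    using IH[OF s1, of "a @ y # x # b" u v d] uv by simp
  have 2: "f (a @ x # y # b @ v # u # d) =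
      f (a @ y # x # b @ v # u # d) + subst_sum f a (\<gamma> x y) (b @ v # u # d)"
    using IH[OF s2, of a x y "b @ v # u # d"] xy by simp
  have 3: "subst_sum f a (\<gamma> x y) (b @ u # v # d) = subst_sum f a (\<gamma> x y) (b @ v # u # d)
      + (\<Sum>c | \<gamma> x y c \<noteq> 0. \<gamma> x y c * subst_sum f (a @ c # b) (\<gamma> u v) d)"
  proof -
    have "f (a @ c # b @ u # v # d) = f (a @ c # b @ v # u # d) + subst_sum f (a @ c # b) (\<gamma> u v) d" for c
      by (rule IH[of _ "a @ c # b", simplified]) (use uv w in \<open>simp_all add: smaller_length\<close>)
    then show ?thesis by (simp add: subst_sum_def[of _ a] distrib_left sum.distrib)
  qed
  have 4: "subst_sum f (a @ x # y # b) (\<gamma> u v) d = subst_sum f (a @ y # x # b) (\<gamma> u v) d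
      + (\<Sum>c | \<gamma> u v c \<noteq> 0. \<gamma> u v c * subst_sum f a (\<gamma> x y) (b @ c # d))"
  proof -
    have "f (a @ x # y # b @ c # d) = f (a @ y # x # b @ c # d) + subst_sum f a (\<gamma> x y) (b @ c # d)" for c
      by (rule IH) (use xy w in \<open>simp_all add: smaller_length\<close>)
    then show ?thesis by (simp add: subst_sum_def[of _ "_ @ _"] distrib_left sum.distrib)
  qed
  show ?thesis
    using subst_sum_commute[of "\<gamma> x y" f a b "\<gamma> u v" d] by (simp add: contract_def 1 2 3 4)
qed

text \<open>Both ways of sorting x y z end in z y x. The leftover terms differ by [[y,z],x] -
  [[x,z],y] + [[x,y],z], read as a combination of single letters placed between \<open>a\<close> and
  \<open>b\<close>, and this is 0 by \<open>jacobi\<close>.\<close>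

lemma contract_overlap:
  assumes IH: "\<And>u a x y b. (u, w) \<in> smaller \<Longrightarrow> u = a @ x # y # b \<Longrightarrow> lt y x \<Longrightarrow> compat x y \<Longrightarrow>
      f u = f (a @ y # x # b) + subst_sum f a (\<gamma> x y) b"
    and w: "w = a @ x # y # z # b" and xy: "lt y x" "compat x y" and yz: "lt z y" "compat y z"
  shows "contract f (a, x, y, z # b) = contract f (a @ [x], y, z, b)"
proof -
  obtain T where T: "T \<in> sides" "x \<in> T" "y \<in> T" "z \<in> T"
    using xy yz overlap unfolding compat_def by metis
  have xz: "lt z x" "compat x z" using lt_trans xy yz T by (auto simp: compat_def)
  have s1: "(a @ y # x # z # b, w) \<in> smaller" using smaller_swap[OF xy(1), of a "z # b"] w by simp
  have s2: "(a @ x # z # y # b, w) \<in> smaller" using smaller_swap[OF yz(1), of "a @ [x]" b] w by simp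
  have s3: "(a @ y # z # x # b, w) \<in> smaller"
    using smaller_swap[OF xz(1), of "a @ [y]" b] s1 smaller_trans by simp
  have s4: "(a @ z # x # y # b, w) \<in> smaller"
    using smaller_swap[OF xz(1), of a "y # b"] s2 smaller_trans by simp
  have e1: "f (a @ y # x # z # b) = f (a @ z # y # x # b) + subst_sum f a (\<gamma> y z) (x # b)
      + subst_sum f (a @ [y]) (\<gamma> x z) b"
    using IH[OF s1, of "a @ [y]" x z b] IH[OF s3, of a y z "x # b"] xz yz by simp
  have e2: "f (a @ x # z # y # b) = f (a @ z # y # x # b) + subst_sum f (a @ [z]) (\<gamma> x y) b
      + subst_sum f a (\<gamma> x z) (y # b)"
    using IH[OF s2, of a x z "y # b"] IH[OF s4, of "a @ [z]" x y b] xz xy by simp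
  \<comment> \<open>Common finite index sets for the letters of single brackets (\<open>F\<close>)
    and of double brackets (\<open>F'\<close>), so that the sums can be combined and
    interchanged.\<close>
  define F where "F = (\<Union>(p, q) \<in> {(y, z), (x, z), (x, y)}. {c. \<gamma> p q c \<noteq> 0})"
  define F' where "F' = (\<Union>(c, q) \<in> F \<times> {x, y, z}. {e. \<gamma> c q e \<noteq> 0})"
  have fin: "finite F" by (auto simp: F_def finite_supp)
  have fin': "finite F'" using fin by (auto simp: F'_def finite_supp)
  have FT: "c \<in> T" if "c \<in> F" for c
    using that closed[OF T(1), of y z c] closed[OF T(1), of x z c] closed[OF T(1), of x y c] T
    by (auto simp: F_def)
  \<comment> \<open>Each difference c s - s c becomes the bracket [c,s]. The words involved are one
    letter shorter than \<open>w\<close>, so the induction hypothesis is available whichever of the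
    two letters is larger.\<close>
  have comm: "subst_sum f a (\<gamma> p q) (s # b) - subst_sum f (a @ [s]) (\<gamma> p q) b =
      (\<Sum>e\<in>F'. (\<Sum>c\<in>F. \<gamma> p q c * \<gamma> c s e) * f (a @ e # b))"
    if pq: "(p, q) \<in> {(y, z), (x, z), (x, y)}" and s: "s \<in> {x, y, z}" for p q s
  proof -
    have sub: "{c. \<gamma> p q c \<noteq> 0} \<subseteq> F" using pq by (auto simp: F_def)
    have "f (a @ c # s # b) - f (a @ s # c # b) = (\<Sum>e\<in>F'. \<gamma> c s e * f (a @ e # b))" if c: "c \<in> F" for c
    proof -
      have K: "compat c s" using s T FT[OF c] by (auto simp: compat_def)
      have "f (a @ c # s # b) = f (a @ s # c # b) + subst_sum f a (\<gamma> c s) b"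
      proof (rule swap_any_order[OF _ refl K])
        fix a' x' y' b'
        assume u: "a @ c # s # b = a' @ x' # y' # b' \<or> a @ c # s # b = a' @ y' # x' # b'"
          and *: "lt y' x'" "compat x' y'"
        have "length (a' @ x' # y' # b') < length w" 
        proof -
          have "length (a @ c # s # b) = length (a' @ x' # y' # b')"
            using u by (elim disjE) simp_all
          then show ?thesis using w by simp
        qed
        then show "f (a' @ x' # y' # b') = f (a' @ y' # x' # b') + subst_sum f a' (\<gamma> x' y') b'"
          using IH[OF smaller_length refl *] by simp
      qed
      moreover have "{e. \<gamma> c s e \<noteq> 0} \<subseteq> F'" using c s by (auto simp: F'_def)
      ultimately show ?thesis using subst_sum_superset[OF fin'] by simp
    qed
    then have "subst_sum f a (\<gamma> p q) (s # b) - subst_sum f (a @ [s]) (\<gamma> p q) b =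
        (\<Sum>c\<in>F. \<gamma> p q c * (\<Sum>e\<in>F'. \<gamma> c s e * f (a @ e # b)))"
      by (simp add: subst_sum_superset[OF fin sub] sum_subtractf[symmetric] right_diff_distrib[symmetric])
    also have "\<dots> = (\<Sum>e\<in>F'. (\<Sum>c\<in>F. \<gamma> p q c * \<gamma> c s e) * f (a @ e # b))"
      by (simp add: sum_distrib_left sum_distrib_right mult.assoc sum.swap[of _ F'])
    finally show ?thesis .
  qed
  have jac: "(\<Sum>c\<in>F. \<gamma> y z c * \<gamma> c x e) - (\<Sum>c\<in>F. \<gamma> x z c * \<gamma> c y e) + (\<Sum>c\<in>F. \<gamma> x y c * \<gamma> c z e) = 0" for e
  proof -
    have "(\<Sum>c\<in>F. \<gamma> p q c * \<gamma> c s e) = (\<Sum>c | \<gamma> p q c \<noteq> 0. \<gamma> p q c * \<gamma> c s e)"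
      if "(p, q) \<in> {(y, z), (x, z), (x, y)}" for p q s
      by (rule sum.mono_neutral_right) (use fin that in \<open>auto simp: F_def\<close>)
    then show ?thesis using jacobi[OF T] by simp
  qed
  have "(\<Sum>e\<in>F'. (\<Sum>c\<in>F. \<gamma> y z c * \<gamma> c x e) * f (a @ e # b))
      - (\<Sum>e\<in>F'. (\<Sum>c\<in>F. \<gamma> x z c * \<gamma> c y e) * f (a @ e # b))
      + (\<Sum>e\<in>F'. (\<Sum>c\<in>F. \<gamma> x y c * \<gamma> c z e) * f (a @ e # b))
      = (\<Sum>e\<in>F'. ((\<Sum>c\<in>F. \<gamma> y z c * \<gamma> c x e) - (\<Sum>c\<in>F. \<gamma> x z c * \<gamma> c y e)
          + (\<Sum>c\<in>F. \<gamma> x y c * \<gamma> c z e)) * f (a @ e # b))"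
    by (simp add: left_diff_distrib distrib_right sum.distrib sum_subtractf)
  also have "\<dots> = 0" unfolding jac by simp
  finally have "(subst_sum f a (\<gamma> y z) (x # b) - subst_sum f (a @ [x]) (\<gamma> y z) b)
      - (subst_sum f a (\<gamma> x z) (y # b) - subst_sum f (a @ [y]) (\<gamma> x z) b)
      + (subst_sum f a (\<gamma> x y) (z # b) - subst_sum f (a @ [z]) (\<gamma> x y) b) = 0"
    by (simp add: comm)
  then show ?thesis by (simp add: contract_def e1 e2 algebra_simps)
qed

text \<open>Confluence: by well-founded induction the value of \<open>extension\<close> does not depend on the redex
  that is contracted first. The disjoint case is formal, the overlapping case is the Jacobi
  identity.\<close>

lemma extension_contract:
  "redex w r \<Longrightarrow> extension f w = contract (extension f) r"
proof (induction w arbitrary: r rule: wf_induct_rule[OF wf_smaller])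
  case (1 w)
  have IH: "extension f u = extension f (a @ y # x # b) + subst_sum (extension f) a (\<gamma> x y) b"
    if "(u, w) \<in> smaller" "u = a @ x # y # b" "lt y x" "compat x y" for u a x y b
    using 1(1)[OF that(1), of "(a, x, y, b)"] that by (simp add: redex_def contract_def)
  have same: "contract (extension f) r = contract (extension f) r'"
    if r: "redex w r" and r': "redex w r'" and le: "length (fst r) \<le> length (fst r')" for r r'
  proof -
    obtain a x y b where ra: "r = (a, x, y, b)" by (cases r) auto
    obtain a' x' y' b' where ra': "r' = (a', x', y', b')" by (cases r') auto
    have w: "w = a @ x # y # b" "lt y x" "compat x y" using r ra by (auto simp: redex_def)
    have w': "w = a' @ x' # y' # b'" "lt y' x'" "compat x' y'" using r' ra' by (auto simp: redex_def)
    \<comment> \<open>\<open>d\<close> is the offset between the two redexes: empty if they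
      coincide, one letter if they overlap, at least two letters if they are disjoint.\<close>
    obtain d where d: "a' = a @ d" "x # y # b = d @ x' # y' # b'"
      using w(1) w'(1) le ra ra' by (auto simp: append_eq_append_conv2)
    show ?thesis
    proof (cases d)
      case Nil
      then show ?thesis using d ra ra' by simp
    next
      case (Cons p d')
      show ?thesis
      proof (cases d')
        case Nil
        then show ?thesis
          using contract_overlap[OF IH, of w a x y y' b'] w w' d Cons ra ra' by simp
      next
        case (Cons q d'')
        then show ?thesis
          using contract_disjoint[OF IH, of w a x y d'' x' y' b'] w w' d \<open>d = p # d'\<close> ra ra' by simp
      qed
    qed
  qed
  obtain r' where "redex w r'" "extension f w = contract (extension f) r'"
    using extension_redex[OF 1(2)] by metis
  then show ?case using same[OF 1(2)] same[OF _ 1(2)] by (metis nle_le)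
qed

lemma extension_admissible: "extension f \<in> admissible"
  unfolding admissible_def
proof (clarify)
  fix a x y b assume "compat x y"
  then show "extension f (a @ x # y # b) =
      extension f (a @ y # x # b) + subst_sum (extension f) a (\<gamma> x y) b"
    by (rule swap_any_order[rotated 2, OF _ ])
      (use extension_contract in \<open>auto simp: redex_def contract_def\<close>)
qed

text \<open>A one-letter word has no redex, so the prescribed value survives. This is the part of
  Poincare-Birkhoff-Witt that matters: letters stay linearly independent modulo the
  relations.\<close>

lemma admissible_point:
  obtains f where "f \<in> admissible" "\<And>y. f [y] = (if y = x then 1 else 0)"
proof
  show "extension (\<lambda>w. if w = [x] then 1 else 0) \<in> admissible" by (rule extension_admissible)
  show "extension (\<lambda>w. if w = [x] then 1 else 0) [y] = (if y = x then 1 else 0)" for y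
    by (subst extension_normal) (auto simp: redex_def append_eq_Cons_conv)
qed

end

section \<open>Fibre products and images\<close>

definition prod_leibniz ::
  "('k::field, 'a::ab_group_add) leibniz \<Rightarrow> ('k, 'b::ab_group_add) leibniz \<Rightarrow> ('k, 'a \<times> 'b) leibniz" where
  "prod_leibniz G H = \<lparr>lcarrier = lcarrier G \<times> lcarrier H,
     lscale = (\<lambda>c z. (lscale G c (fst z), lscale H c (snd z))),
     bracket = (\<lambda>z w. (bracket G (fst z) (fst w), bracket H (snd z) (snd w)))\<rparr>"

lemma leibniz_algebra_prod:
  assumes "leibniz_algebra G" "leibniz_algebra H"
  shows "leibniz_algebra (prod_leibniz G H)"
proof -
  interpret G: leibniz_algebra G by fact
  interpret H: leibniz_algebra H by fact
  interpret P: vector_space "lscale (prod_leibniz G H)"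
    by unfold_locales
      (auto simp: prod_leibniz_def G.scale_right_distrib H.scale_right_distrib
        G.scale_left_distrib H.scale_left_distrib)
  show ?thesis
  proof
    show "P.subspace (lcarrier (prod_leibniz G H))"
      by (rule P.subspaceI) (auto simp: prod_leibniz_def G.carrier_closed H.carrier_closed zero_prod_def)
  qed (auto simp: prod_leibniz_def G.carrier_closed H.carrier_closed
      G.bracket_add_left H.bracket_add_left G.bracket_add_right H.bracket_add_right
      G.bracket_scale_left H.bracket_scale_left G.bracket_scale_right H.bracket_scale_right
      G.leibniz_identity H.leibniz_identity)
qed

definition fibre_leibniz ::
  "('k::field, 'a::ab_group_add) leibniz \<Rightarrow> ('k, 'b::ab_group_add) leibniz \<Rightarrow> ('a \<Rightarrow> 'c) \<Rightarrow> ('b \<Rightarrow> 'c) \<Rightarrow>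
    ('k, 'a \<times> 'b) leibniz" where
  "fibre_leibniz G H p q = (prod_leibniz G H)\<lparr>lcarrier :=
     {z \<in> lcarrier G \<times> lcarrier H. p (fst z) = q (snd z)}\<rparr>"

lemma fibre_leibniz_simps [simp]:
  "z \<in> lcarrier (fibre_leibniz G H p q) \<longleftrightarrow>
     fst z \<in> lcarrier G \<and> snd z \<in> lcarrier H \<and> p (fst z) = q (snd z)"
  "lscale (fibre_leibniz G H p q) c z = (lscale G c (fst z), lscale H c (snd z))"
  "bracket (fibre_leibniz G H p q) z w = (bracket G (fst z) (fst w), bracket H (snd z) (snd w))"
  "lie_sym (fibre_leibniz G H p q) z w = (lie_sym G (fst z) (fst w), lie_sym H (snd z) (snd w))"
  by (auto simp: fibre_leibniz_def prod_leibniz_def lie_sym_def mem_Times_iff)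

lemma leibniz_algebra_fibre:
  assumes G: "leibniz_algebra G" and H: "leibniz_algebra H"
    and p: "leibniz_hom G Q p" and q: "leibniz_hom H Q q"
  shows "leibniz_algebra (fibre_leibniz G H p q)"
proof -
  interpret G: leibniz_algebra G by fact
  interpret H: leibniz_algebra H by fact
  interpret P: leibniz_algebra "prod_leibniz G H" using G H by (rule leibniz_algebra_prod)
  note h = leibniz_homD[OF p] leibniz_homD[OF q] G.hom_zero[OF p] H.hom_zero[OF q]
  show ?thesis
    unfolding fibre_leibniz_def
  proof (rule P.subalgebra)
    show "P.subspace {z \<in> lcarrier G \<times> lcarrier H. p (fst z) = q (snd z)}"
      by (rule P.subspaceI)
        (auto simp: prod_leibniz_def h G.carrier_closed H.carrier_closed zero_prod_def)
  qed (auto simp: prod_leibniz_def h G.carrier_closed H.carrier_closed)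
qed

text \<open>The quotient of \<open>G\<close> by the kernel of \<open>T\<close>, represented by the
  image of \<open>T\<close>; brackets are computed on chosen preimages.\<close>

definition image_leibniz ::
  "('k::field \<Rightarrow> 'b \<Rightarrow> 'b) \<Rightarrow> ('a \<Rightarrow> 'b) \<Rightarrow> ('k, 'a::ab_group_add) leibniz \<Rightarrow> ('k, 'b::ab_group_add) leibniz" where
  "image_leibniz s T G = \<lparr>lcarrier = T ` lcarrier G, lscale = s,
     bracket = (\<lambda>u v. T (bracket G (inv_into (lcarrier G) T u) (inv_into (lcarrier G) T v)))\<rparr>"

lemma image_leibniz:
  assumes G: "leibniz_algebra G" and s: "vector_space s"
    and add: "\<And>x y. x \<in> lcarrier G \<Longrightarrow> y \<in> lcarrier G \<Longrightarrow> T (x + y) = T x + T y"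
    and scale: "\<And>c x. x \<in> lcarrier G \<Longrightarrow> T (lscale G c x) = s c (T x)"
    and ideal: "\<And>x y. x \<in> lcarrier G \<Longrightarrow> T x = 0 \<Longrightarrow> y \<in> lcarrier G \<Longrightarrow>
      T (bracket G x y) = 0 \<and> T (bracket G y x) = 0"
  shows "leibniz_algebra (image_leibniz s T G)" "leibniz_hom G (image_leibniz s T G) T"
proof -
  interpret G: leibniz_algebra G by fact
  interpret V: vector_space s by fact
  let ?H = "image_leibniz s T G"
  have zero: "T 0 = 0" using add[of 0 0] by simp
  have diff: "T (x - y) = T x - T y" if "x \<in> lcarrier G" "y \<in> lcarrier G" for x y
    using add[of "x - y" y] that by (simp add: G.carrier_diff algebra_simps)
  \<comment> \<open>Independence of the preimages: [x,y] - [x',y'] = [x - x',y] + [x',y - y'], and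
    both summands are in the kernel of \<open>T\<close> because it is an ideal.\<close>
  have eq: "T (bracket G x y) = T (bracket G x' y')"
    if c: "x \<in> lcarrier G" "x' \<in> lcarrier G" "y \<in> lcarrier G" "y' \<in> lcarrier G"
      and e: "T x = T x'" "T y = T y'" for x x' y y'
  proof -
    have "T (bracket G (x - x') y) = 0" "T (bracket G x' (y - y')) = 0"
      using ideal[of "x - x'" y] ideal[of "y - y'" x'] c e by (simp_all add: diff G.carrier_diff)
    then show ?thesis using c by (simp add: G.bracket_diff_left G.bracket_diff_right diff G.bracket_closed)
  qed
  have br: "bracket ?H (T x) (T y) = T (bracket G x y)" if "x \<in> lcarrier G" "y \<in> lcarrier G" for x y
    using that by (auto simp: image_leibniz_def inv_into_into f_inv_into_f intro!: eq)
  have car: "lcarrier ?H = T ` lcarrier G" and sc: "lscale ?H = s"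
    by (simp_all add: image_leibniz_def)
  show "leibniz_hom G ?H T"
    by (rule leibniz_homI) (simp_all add: add scale br car sc)
  interpret H: vector_space "lscale ?H" by (simp add: sc s)
  show "leibniz_algebra ?H"
  proof
    show "H.subspace (lcarrier ?H)"
      unfolding car
    proof (rule H.subspaceI)
      show "0 \<in> T ` lcarrier G" using zero G.carrier_zero by force
      show "u + v \<in> T ` lcarrier G" if "u \<in> T ` lcarrier G" "v \<in> T ` lcarrier G" for u v
        using that G.carrier_add by (auto simp: add[symmetric])
      show "lscale ?H c u \<in> T ` lcarrier G" if "u \<in> T ` lcarrier G" for c u
        using that G.carrier_scale by (auto simp: sc scale[symmetric])
    qed
  qed (auto simp: car br sc add[symmetric] scale[symmetric] diff[symmetric] G.carrier_closed
      G.bracket_add_left G.bracket_add_right G.bracket_scale_left G.bracket_scale_right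
      G.leibniz_identity)
qed

section \<open>The fibre product of two isoclinic extensions\<close>

locale isoclinic_pair =
  fixes E1 :: "('k::field, 'n1::ab_group_add, 'g1::ab_group_add, 'q1::ab_group_add) leibniz_ext"
    and E2 :: "('k, 'n2::ab_group_add, 'g2::ab_group_add, 'q2::ab_group_add) leibniz_ext"
    and \<eta> \<xi>
  assumes E1: "lie_central_extension E1" and E2: "lie_central_extension E2"
    and iso: "lie_isoclinism E1 E2 \<eta> \<xi>"
begin

abbreviation "g1 \<equiv> ext_mid E1"
abbreviation "g2 \<equiv> ext_mid E2"
abbreviation "p1 \<equiv> ext_proj E1"
abbreviation "p2 \<equiv> ext_proj E2"

sublocale G1: leibniz_algebra g1 using lie_central_extensionD[OF E1] by auto
sublocale G2: leibniz_algebra g2 using lie_central_extensionD[OF E2] by auto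

lemma eta: "leibniz_hom (ext_quo E1) (ext_quo E2) \<eta>"
    "bij_betw \<eta> (lcarrier (ext_quo E1)) (lcarrier (ext_quo E2))"
    "leibniz_iso (ext_quo E1) (ext_quo E2) \<eta>"
  using iso by (auto simp: lie_isoclinism_def leibniz_iso_def)

lemma xi:
  shows "l \<in> lie_derived g1 \<Longrightarrow> \<xi> l \<in> lie_derived g2"
    and "l \<in> lie_derived g1 \<Longrightarrow> m \<in> lie_derived g1 \<Longrightarrow> \<xi> (l + m) = \<xi> l + \<xi> m"
    and "l \<in> lie_derived g1 \<Longrightarrow> \<xi> (lscale g1 c l) = lscale g2 c (\<xi> l)"
    and "inj_on \<xi> (lie_derived g1)"
    and "\<xi> 0 = 0"
proof -
  interpret L: leibniz_algebra "lie_commutator_algebra g1" by (rule G1.leibniz_algebra_derived)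
  have i: "leibniz_iso (lie_commutator_algebra g1) (lie_commutator_algebra g2) \<xi>"
    using iso by (simp add: lie_isoclinism_def)
  then have h: "leibniz_hom (lie_commutator_algebra g1) (lie_commutator_algebra g2) \<xi>"
    by (simp add: leibniz_iso_def)
  show "\<xi> 0 = 0" by (rule L.hom_zero[OF h])
  show "inj_on \<xi> (lie_derived g1)"
    using i by (simp add: leibniz_iso_def bij_betw_def lie_commutator_algebra_def)
qed (use iso in \<open>auto simp: lie_isoclinism_def leibniz_iso_def leibniz_hom_def lie_commutator_algebra_def\<close>)

lemma proj: "leibniz_hom g1 (ext_quo E1) p1" "leibniz_hom g2 (ext_quo E2) p2"
    "x \<in> lcarrier g1 \<Longrightarrow> p1 x \<in> lcarrier (ext_quo E1)"
    "y \<in> lcarrier g2 \<Longrightarrow> p2 y \<in> lcarrier (ext_quo E2)"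
  using lie_central_extensionD[OF E1] lie_central_extensionD[OF E2] by (auto simp: leibniz_hom_def)

lemma eta_proj_hom: "leibniz_hom g1 (ext_quo E2) (\<lambda>x. \<eta> (p1 x))"
  using leibniz_homD[OF proj(1)] leibniz_homD[OF eta(1)] by (auto intro!: leibniz_homI)

definition "fibre = fibre_leibniz g1 g2 (\<lambda>x. \<eta> (p1 x)) p2"

lemma fibre_simps [simp]:
  "z \<in> lcarrier fibre \<longleftrightarrow> fst z \<in> lcarrier g1 \<and> snd z \<in> lcarrier g2 \<and> \<eta> (p1 (fst z)) = p2 (snd z)"
  "lscale fibre c z = (lscale g1 c (fst z), lscale g2 c (snd z))"
  "bracket fibre z w = (bracket g1 (fst z) (fst w), bracket g2 (snd z) (snd w))"
  "lie_sym fibre z w = (lie_sym g1 (fst z) (fst w), lie_sym g2 (snd z) (snd w))"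
  by (simp_all add: fibre_def)

sublocale F: leibniz_algebra fibre
  unfolding fibre_def
  by (rule leibniz_algebra_fibre[OF G1.leibniz_algebra_axioms G2.leibniz_algebra_axioms
        eta_proj_hom proj(2)])

lemma fibre_over_left: "x \<in> lcarrier g1 \<Longrightarrow> \<exists>y. (x, y) \<in> lcarrier fibre"
proof -
  assume x: "x \<in> lcarrier g1"
  then have "\<eta> (p1 x) \<in> p2 ` lcarrier g2"
    using lie_central_extensionD(8)[OF E2] leibniz_homD(1)[OF eta_proj_hom] by simp
  then show ?thesis using x by auto
qed

lemma fibre_over_right: "y \<in> lcarrier g2 \<Longrightarrow> \<exists>x. (x, y) \<in> lcarrier fibre"
proof -
  assume y: "y \<in> lcarrier g2"
  then have "p2 y \<in> \<eta> ` p1 ` lcarrier g1"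
    using lie_central_extensionD(8)[OF E1] eta(2) proj(4) by (simp add: bij_betw_def)
  then show ?thesis using y by auto
qed

text \<open>On a commutator of two pairs this is the compatibility of \<xi> with the two commutator
  maps, taken at the base points of the pairs; linearity of \<xi> on the commutator ideal does the
  rest.\<close>

lemma fibre_derived: "z \<in> lie_derived fibre \<Longrightarrow> fst z \<in> lie_derived g1 \<and> snd z = \<xi> (fst z)"
proof (induction z rule: F.lie_derived_induct)
  case zero
  then show ?case using G1.subspace_0[OF G1.lie_derived_subspace] xi(5) by simp
next
  case (sym z w)
  then have "\<xi> (lie_commutator_map E1 (p1 (fst z)) (p1 (fst w))) =
      lie_commutator_map E2 (\<eta> (p1 (fst z))) (\<eta> (p1 (fst w)))"
    using iso by (simp add: lie_isoclinism_def proj(3))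
  then have "\<xi> (lie_sym g1 (fst z) (fst w)) = lie_sym g2 (snd z) (snd w)"
    using sym lie_commutator_map_proj[OF E1, of "fst z" "fst w"]
      lie_commutator_map_proj[OF E2, of "snd z" "snd w"]
    by simp
  then show ?case using sym by (simp add: G1.lie_sym_in_derived)
next
  case (add l m)
  then show ?case by (simp add: xi G1.subspace_add[OF G1.lie_derived_subspace])
next
  case (scale c l)
  then show ?case by (simp add: xi G1.subspace_scale[OF G1.lie_derived_subspace])
qed

definition "fibre_ext = \<lparr>ext_ker = prod_leibniz (ext_ker E1) (ext_ker E2), ext_mid = fibre,
  ext_quo = ext_quo E1, ext_inc = map_prod (ext_inc E1) (ext_inc E2), ext_proj = (\<lambda>z. p1 (fst z))\<rparr>"

lemma fibre_ext_central: "lie_central_extension fibre_ext"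
proof (rule lie_central_extensionI, unfold fibre_ext_def leibniz_ext.simps)
  note D1 = lie_central_extensionD[OF E1] and D2 = lie_central_extensionD[OF E2]
  have im: "ext_inc E1 n \<in> lcarrier g1" "p1 (ext_inc E1 n) = 0" if "n \<in> lcarrier (ext_ker E1)" for n
    using D1(7) that by blast+
  have im2: "ext_inc E2 n \<in> lcarrier g2" "p2 (ext_inc E2 n) = 0" if "n \<in> lcarrier (ext_ker E2)" for n
    using D2(7) that by blast+
  have e0: "\<eta> 0 = 0" using leibniz_algebra.hom_zero[OF D1(3) eta(1)] .
  show "leibniz_algebra (prod_leibniz (ext_ker E1) (ext_ker E2))"
    using D1 D2 by (simp add: leibniz_algebra_prod)
  show "leibniz_algebra fibre" by unfold_locales
  show "leibniz_algebra (ext_quo E1)" by (rule D1)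
  show "leibniz_hom (prod_leibniz (ext_ker E1) (ext_ker E2)) fibre (map_prod (ext_inc E1) (ext_inc E2))"
    using leibniz_homD[OF D1(4)] leibniz_homD[OF D2(4)]
    by (auto simp: prod_leibniz_def im im2 e0 intro!: leibniz_homI)
  show "leibniz_hom fibre (ext_quo E1) (\<lambda>z. p1 (fst z))"
    using leibniz_homD[OF proj(1)] by (auto intro!: leibniz_homI)
  show "inj_on (map_prod (ext_inc E1) (ext_inc E2)) (lcarrier (prod_leibniz (ext_ker E1) (ext_ker E2)))"
    using D1(6) D2(6) by (auto simp: prod_leibniz_def intro: map_prod_inj_on)
  have "(x, y) \<in> map_prod (ext_inc E1) (ext_inc E2) ` (lcarrier (ext_ker E1) \<times> lcarrier (ext_ker E2)) \<longleftrightarrow>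
      x \<in> ext_inc E1 ` lcarrier (ext_ker E1) \<and> y \<in> ext_inc E2 ` lcarrier (ext_ker E2)" for x y
    by auto
  note im_iff = this
  show "map_prod (ext_inc E1) (ext_inc E2) ` lcarrier (prod_leibniz (ext_ker E1) (ext_ker E2)) =
      {z \<in> lcarrier fibre. p1 (fst z) = 0}"
  proof (rule set_eqI)
    fix z
    show "z \<in> map_prod (ext_inc E1) (ext_inc E2) ` lcarrier (prod_leibniz (ext_ker E1) (ext_ker E2))
        \<longleftrightarrow> z \<in> {z \<in> lcarrier fibre. p1 (fst z) = 0}"
      using e0 by (cases z) (simp add: prod_leibniz_def im_iff D1(7) D2(7), metis)
  qed
  show "(\<lambda>z. p1 (fst z)) ` lcarrier fibre = lcarrier (ext_quo E1)"
  proof (intro equalityI subsetI)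
    fix a assume "a \<in> lcarrier (ext_quo E1)"
    then obtain x where x: "x \<in> lcarrier g1" "a = p1 x" using D1(8) by blast
    then obtain y where "(x, y) \<in> lcarrier fibre" using fibre_over_left by blast
    then show "a \<in> (\<lambda>z. p1 (fst z)) ` lcarrier fibre"
      using x by (intro image_eqI[of _ _ "(x, y)"]) simp_all
  qed (auto simp: proj(3))
  show "lie_sym fibre z w = 0" if z: "z \<in> lcarrier fibre" "p1 (fst z) = 0" and w: "w \<in> lcarrier fibre" for z w
    using D1(9)[of "fst z" "fst w"] D2(9)[of "snd z" "snd w"] z w e0 by (auto simp: zero_prod_def)
qed

text \<open>On the graph of \<xi> the projection \<open>fst\<close> has trivial kernel since \<xi>
  maps 0 to 0, and \<open>snd\<close> has trivial kernel since \<xi> is injective. The quotient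
  being \<open>ext_quo E1\<close>, the maps induced on quotients are the identity and
  \<eta>.\<close>

lemma isoclinic_epis_onto_fibre_ext: "isoclinic_epis_onto fibre_ext E1 E2"
proof -
  have q: "leibniz_iso (ext_quo E1) (ext_quo E1) (\<lambda>x. x)" by (rule leibniz_iso_id)
  have "lie_isoclinic_epi fibre_ext E1 fst fst (\<lambda>x. x)"
    unfolding lie_isoclinic_epi_def
  proof (intro conjI lie_isoclinic_homI fibre_ext_central E1)
    show "ext_hom fibre_ext E1 fst fst (\<lambda>x. x)"
      by (auto simp: ext_hom_def fibre_ext_def leibniz_hom_def prod_leibniz_def)
    show "l = 0" if "l \<in> lie_derived (ext_mid fibre_ext)" "fst l = 0" for l
      using fibre_derived[of l] that xi(5) by (auto simp: fibre_ext_def prod_eq_iff)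
    show "fst ` lcarrier (ext_mid fibre_ext) = lcarrier g1"
    proof (intro equalityI subsetI)
      fix x assume x: "x \<in> lcarrier g1"
      then obtain y where "(x, y) \<in> lcarrier fibre" using fibre_over_left by blast
      then show "x \<in> fst ` lcarrier (ext_mid fibre_ext)"
        by (intro image_eqI[of _ _ "(x, y)"]) (simp_all add: fibre_ext_def)
    qed (auto simp: fibre_ext_def)
  qed (simp add: fibre_ext_def q)
  moreover have "lie_isoclinic_epi fibre_ext E2 snd snd \<eta>"
    unfolding lie_isoclinic_epi_def
  proof (intro conjI lie_isoclinic_homI fibre_ext_central E2)
    show "ext_hom fibre_ext E2 snd snd \<eta>"
      using eta(1) by (auto simp: ext_hom_def fibre_ext_def leibniz_hom_def prod_leibniz_def)
    show "l = 0" if "l \<in> lie_derived (ext_mid fibre_ext)" "snd l = 0" for l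
      using fibre_derived[of l] that xi(4,5) G1.subspace_0[OF G1.lie_derived_subspace]
      by (auto simp: fibre_ext_def prod_eq_iff inj_on_def)
    show "snd ` lcarrier (ext_mid fibre_ext) = lcarrier g2"
    proof (intro equalityI subsetI)
      fix y assume y: "y \<in> lcarrier g2"
      then obtain x where "(x, y) \<in> lcarrier fibre" using fibre_over_right by blast
      then show "y \<in> snd ` lcarrier (ext_mid fibre_ext)"
        by (intro image_eqI[of _ _ "(x, y)"]) (simp_all add: fibre_ext_def)
    qed (auto simp: fibre_ext_def)
  qed (simp add: fibre_ext_def eta)
  ultimately show ?thesis unfolding isoclinic_epis_onto_def using fibre_ext_central by blast
qed

end

section \<open>Coordinates modulo the commutator ideal\<close>

lemma (in vector_space) independent_Un_trivial_Int:
  assumes A: "independent A" and B: "independent B" and AB: "span A \<inter> span B = {0}"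
  shows "independent (A \<union> B)"
  unfolding independent_explicit_module
proof (intro allI impI)
  fix t u v
  assume t: "finite t" "t \<subseteq> A \<union> B" and s: "(\<Sum>v\<in>t. scale (u v) v) = 0" and v: "v \<in> t"
  let ?a = "\<Sum>v\<in>t \<inter> A. scale (u v) v" and ?b = "\<Sum>v\<in>t - A. scale (u v) v"
  have "?a + ?b = 0"
    using s t(1) by (subst sum.union_disjoint[symmetric]) (auto simp: Int_Diff_Un)
  moreover have a: "?a \<in> span A" by (intro span_sum span_scale span_base) auto
  moreover have b: "?b \<in> span B" by (intro span_sum span_scale span_base) (use t in auto)
  ultimately have "?a = - ?b" by (simp add: eq_neg_iff_add_eq_0)
  then have "?a \<in> span A \<inter> span B" using a b span_neg[OF b] by simp
  then have "?a = 0" "?b = 0" using AB \<open>?a = - ?b\<close> by auto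
  then show "u v = 0"
    using independentD[OF A, of "t \<inter> A" u v] independentD[OF B, of "t - A" u v] t v by blast
qed

text \<open>Coordinates \<open>c v x\<close> of vectors modulo \<open>lie_derived G\<close>, with \<open>e x\<close> a lift of the basis vector
  labelled \<open>x\<close>.\<close>

locale lie_coordinates = leibniz_algebra G for G :: "('k::field, 'a::ab_group_add) leibniz" +
  fixes S :: "'b set" and e :: "'b \<Rightarrow> 'a" and c :: "'a \<Rightarrow> 'b \<Rightarrow> 'k"
  assumes two: "(2::'k) \<noteq> 0"
    and e_carrier: "x \<in> S \<Longrightarrow> e x \<in> lcarrier G"
    and c_support: "v \<in> lcarrier G \<Longrightarrow> c v x \<noteq> 0 \<Longrightarrow> x \<in> S"
    and c_finite: "v \<in> lcarrier G \<Longrightarrow> finite {x. c v x \<noteq> 0}"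
    and c_add: "v \<in> lcarrier G \<Longrightarrow> w \<in> lcarrier G \<Longrightarrow> c (v + w) x = c v x + c w x"
    and c_scale: "v \<in> lcarrier G \<Longrightarrow> c (lscale G a v) x = a * c v x"
    and c_e: "x \<in> S \<Longrightarrow> c (e x) y = (if y = x then 1 else 0)"
    and c_kernel: "v \<in> lcarrier G \<Longrightarrow> (\<forall>x. c v x = 0) \<longleftrightarrow> v \<in> lie_derived G"
begin

lemma functional_sum:
  assumes add: "\<And>v w. v \<in> lcarrier G \<Longrightarrow> w \<in> lcarrier G \<Longrightarrow> \<phi> (v + w) = \<phi> v + \<phi> w"
    and scale: "\<And>a v. v \<in> lcarrier G \<Longrightarrow> \<phi> (lscale G a v) = a * \<phi> v"
    and F: "finite F" "F \<subseteq> S"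
  shows "(\<Sum>x\<in>F. lscale G (a x) (e x)) \<in> lcarrier G \<and>
    \<phi> (\<Sum>x\<in>F. lscale G (a x) (e x)) = (\<Sum>x\<in>F. a x * \<phi> (e x) :: 'k)"
  using F
proof (induction F)
  case empty
  show ?case using scale[of 0 0] by simp
next
  case (insert x F)
  then show ?case by (simp add: add scale e_carrier carrier_closed)
qed

text \<open>The combination \<open>?u\<close> of lifts with the coordinates of \<open>v\<close>
  differs from \<open>v\<close> by an element of the commutator ideal, which \<phi> kills.\<close>

lemma functional_expand:
  assumes add: "\<And>v w. v \<in> lcarrier G \<Longrightarrow> w \<in> lcarrier G \<Longrightarrow> \<phi> (v + w) = \<phi> v + \<phi> w"
    and scale: "\<And>a v. v \<in> lcarrier G \<Longrightarrow> \<phi> (lscale G a v) = a * \<phi> v"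
    and derived: "\<And>l. l \<in> lie_derived G \<Longrightarrow> \<phi> l = 0"
    and v: "v \<in> lcarrier G"
  shows "\<phi> v = (\<Sum>x | c v x \<noteq> 0. c v x * \<phi> (e x) :: 'k)"
proof -
  let ?F = "{x. c v x \<noteq> 0}"
  let ?u = "\<Sum>x\<in>?F. lscale G (c v x) (e x)"
  have F: "finite ?F" "?F \<subseteq> S" using c_finite[OF v] c_support[OF v] by auto
  have u: "?u \<in> lcarrier G" "\<phi> ?u = (\<Sum>x\<in>?F. c v x * \<phi> (e x))"
    using functional_sum[of \<phi>, OF add scale F] by auto
  have cu: "c ?u y = c v y" for y
  proof -
    have "c ?u y = (\<Sum>x\<in>?F. c v x * c (e x) y)"
      using functional_sum[of "\<lambda>v. c v y", OF c_add c_scale F] by auto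
    also have "\<dots> = (\<Sum>x\<in>?F. if y = x then c v x else 0)"
      using F by (intro sum.cong) (auto simp: c_e)
    finally show ?thesis using F by auto
  qed
  have "c (v - ?u) y = 0" for y
    using c_add[of "v - ?u" ?u y] cu[of y] u v by (simp add: carrier_diff)
  then have "v - ?u \<in> lie_derived G" using c_kernel[of "v - ?u"] u v by (simp add: carrier_diff)
  then have "\<phi> (v - ?u) = 0" by (rule derived)
  then show ?thesis using add[of "v - ?u" ?u] u v by (simp add: carrier_diff)
qed

lemma c_derived: "l \<in> lie_derived G \<Longrightarrow> c l x = 0"
  using c_kernel[of l] lie_derived_carrier by blast

lemma c_bracket_expand_left:
  assumes v: "v \<in> lcarrier G" and w: "w \<in> lcarrier G"
  shows "c (bracket G v w) z = (\<Sum>x | c v x \<noteq> 0. c v x * c (bracket G (e x) w) z)"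
  by (rule functional_expand[of "\<lambda>v. c (bracket G v w) z"])
    (use v w in \<open>simp_all add: bracket_add_left bracket_scale_left bracket_closed c_add c_scale
      c_derived bracket_derived_left\<close>)

lemma c_bracket_expand_right:
  assumes v: "v \<in> lcarrier G" and w: "w \<in> lcarrier G"
  shows "c (bracket G v w) z = (\<Sum>x | c w x \<noteq> 0. c w x * c (bracket G v (e x)) z)"
  by (rule functional_expand[of "\<lambda>w. c (bracket G v w) z"])
    (use v w c_derived[OF lie_derived_subspace[THEN subspace_0]] in
      \<open>simp_all add: bracket_add_right bracket_scale_right bracket_closed c_add c_scale
        bracket_derived_right\<close>)

lemma c_bracket:
  assumes v: "v \<in> lcarrier G" and w: "w \<in> lcarrier G"
  shows "c (bracket G v w) z =
    (\<Sum>x | c v x \<noteq> 0. \<Sum>y | c w y \<noteq> 0. c v x * c w y * c (bracket G (e x) (e y)) z)"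
  unfolding c_bracket_expand_left[OF v w]
proof (intro sum.cong refl)
  fix x assume "x \<in> {x. c v x \<noteq> 0}"
  then have "e x \<in> lcarrier G" using c_support[OF v] e_carrier by simp
  then show "c v x * c (bracket G (e x) w) z =
      (\<Sum>y | c w y \<noteq> 0. c v x * c w y * c (bracket G (e x) (e y)) z)"
    using w by (simp add: c_bracket_expand_right sum_distrib_left mult.assoc)
qed

lemma c_diff: "v \<in> lcarrier G \<Longrightarrow> w \<in> lcarrier G \<Longrightarrow> c (v - w) x = c v x - c w x"
  using c_add[of "v - w" w x] by (simp add: carrier_diff)

lemma c_bracket_anti:
  assumes "v \<in> lcarrier G" "w \<in> lcarrier G"
  shows "c (bracket G v w) x = - c (bracket G w v) x"
proof -
  have "c (bracket G v w) x + c (bracket G w v) x = 0"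
    using c_derived[OF lie_sym_in_derived[OF assms]] assms
    by (simp add: lie_sym_def c_add bracket_closed)
  then show ?thesis by (simp add: eq_neg_iff_add_eq_0)
qed

lemma c_bracket_alt: "v \<in> lcarrier G \<Longrightarrow> c (bracket G v v) x = 0"
  using c_derived bracket_self_derived[OF two] by blast

text \<open>Modulo the commutator ideal the outer bracket may be turned around, [[y,z],x] =
  -[x,[y,z]], and the Leibniz identity becomes the Jacobi identity in the form that the rewriting
  asks for.\<close>

lemma c_jacobi:
  assumes x: "x \<in> lcarrier G" and y: "y \<in> lcarrier G" and z: "z \<in> lcarrier G"
  shows "c (bracket G (bracket G y z) x) a - c (bracket G (bracket G x z) y) a
    + c (bracket G (bracket G x y) z) a = 0"
  using c_bracket_anti[of "bracket G y z" x a] assms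
  by (simp add: leibniz_identity[OF x y z] c_diff bracket_closed)

text \<open>Allows the bases of two different algebras to be written in one alphabet, in which a
  common subalgebra gets common letters.\<close>

lemma relabel:
  assumes l: "inj_on l S"
  shows "lie_coordinates G (l ` S) (\<lambda>y. e (inv_into S l y))
    (\<lambda>v y. if y \<in> l ` S then c v (inv_into S l y) else 0)"
proof
  fix v x assume v: "v \<in> lcarrier G"
  have "{y. (if y \<in> l ` S then c v (inv_into S l y) else 0) \<noteq> 0} \<subseteq> l ` {x. c v x \<noteq> 0}"
    using l by (auto split: if_splits)
  then show "finite {y. (if y \<in> l ` S then c v (inv_into S l y) else 0) \<noteq> 0}"
    using c_finite[OF v] finite_surj by blast
  have "(\<forall>y. (if y \<in> l ` S then c v (inv_into S l y) else 0) = 0) \<longleftrightarrow> (\<forall>x. c v x = 0)"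
    using c_support[OF v] l by (auto simp: image_iff) (metis inv_into_f_f)
  then show "(\<forall>y. (if y \<in> l ` S then c v (inv_into S l y) else 0) = 0) \<longleftrightarrow> v \<in> lie_derived G"
    using c_kernel[OF v] by simp
qed (use two l c_support in \<open>auto simp: e_carrier c_add c_scale c_e split: if_splits\<close>)

end

text \<open>By \<open>ND\<close> the set \<open>N\<close> stays independent when a basis
  \<open>L\<close> of the commutator ideal is joined to it. In a basis of the algebra containing
  both, forgetting the coordinates at \<open>L\<close> gives coordinates modulo the ideal that keep
  \<open>N\<close> among the basis vectors.\<close>

lemma (in leibniz_algebra) lie_coordinates_exist:
  assumes two: "(2::'k) \<noteq> 0" and N: "N \<subseteq> lcarrier G" "independent N"
    and ND: "span N \<inter> lie_derived G = {0}"
  obtains S c where "N \<subseteq> S" "lie_coordinates G S (\<lambda>x. x) c"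
proof -
  obtain L where L: "L \<subseteq> lie_derived G" "independent L" "lie_derived G \<subseteq> span L"
    using maximal_independent_subset by metis
  have sL: "span L = lie_derived G"
    using L lie_derived_subspace span_minimal by blast
  have "independent (N \<union> L)" using independent_Un_trivial_Int[OF N(2) L(2)] ND sL by simp
  moreover have "N \<union> L \<subseteq> lcarrier G" using N L lie_derived_carrier by blast
  ultimately obtain B where B: "N \<union> L \<subseteq> B" "B \<subseteq> lcarrier G" "independent B" "lcarrier G \<subseteq> span B"
    using maximal_independent_subset_extend by metis
  have NL: "x \<notin> L" if "x \<in> N" for x
  proof
    assume "x \<in> L"
    then have "x = 0" using ND that sL span_base by blast
    then show False using N(2) dependent_zero that by blast
  qed
  let ?c = "\<lambda>v x. if x \<in> B - L then representation B v x else 0"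
  have "lie_coordinates G (B - L) (\<lambda>x. x) ?c"
  proof
    fix v assume v: "v \<in> lcarrier G"
    then have vB: "v \<in> span B" using B by blast
    show "finite {x. ?c v x \<noteq> 0}"
      by (rule finite_subset[OF _ finite_representation[of B v]]) auto
    show "(\<forall>x. ?c v x = 0) \<longleftrightarrow> v \<in> lie_derived G"
    proof
      assume "v \<in> lie_derived G"
      then have "v \<in> span L" using sL by simp
      then have "representation B v = representation L v"
        using representation_extend[OF B(3)] B(1) by simp
      then show "\<forall>x. ?c v x = 0" using representation_ne_zero[of L v] by auto
    next
      assume z: "\<forall>x. ?c v x = 0"
      have "(\<Sum>b | representation B v b \<noteq> 0. lscale G (representation B v b) b) \<in> span L"
        by (intro span_sum span_scale span_base) (metis (mono_tags, lifting) DiffI mem_Collect_eq representation_ne_zero z)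
      then show "v \<in> lie_derived G"
        using sum_nonzero_representation_eq[OF B(3) vB] sL by simp
    qed
  next
    fix v w x assume "v \<in> lcarrier G" "w \<in> lcarrier G"
    then have "v \<in> span B" "w \<in> span B" using B by auto
    then show "?c (v + w) x = ?c v x + ?c w x"
      using representation_add[OF B(3), of w v] B by auto
  next
    fix v a x assume "v \<in> lcarrier G"
    then show "?c (lscale G a v) x = a * ?c v x"
      using representation_scale[OF B(3), of v a] B by auto
  qed (use two B in \<open>auto simp: representation_basis split: if_splits\<close>)
  moreover have "N \<subseteq> B - L" using B NL by blast
  ultimately show ?thesis using that by blast
qed

text \<open>Maps are set to 0 outside \<open>M\<close>, so that an endomorphism of \<open>M\<close>
  is a single function on the whole type and equality of functions is equality of
  endomorphisms.\<close>

definition gl :: "('k::field \<Rightarrow> 'v \<Rightarrow> 'v) \<Rightarrow> 'v::ab_group_add set \<Rightarrow> ('k, 'v \<Rightarrow> 'v) leibniz" where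
  "gl s M = \<lparr>lcarrier = {f. f ` M \<subseteq> M \<and> (\<forall>x\<in>M. \<forall>y\<in>M. f (x + y) = f x + f y) \<and>
       (\<forall>a. \<forall>x\<in>M. f (s a x) = s a (f x)) \<and> (\<forall>x. x \<notin> M \<longrightarrow> f x = 0)},
     lscale = (\<lambda>a f x. s a (f x)), bracket = (\<lambda>f g x. f (g x) - g (f x))\<rparr>"

lemma leibniz_algebra_gl:
  assumes "vector_space s" and M: "module.subspace s M"
  shows "leibniz_algebra (gl s M)"
proof -
  interpret V: vector_space s by fact
  interpret L: vector_space "lscale (gl s M)"
    by unfold_locales
      (auto simp: gl_def fun_eq_iff V.scale_right_distrib V.scale_left_distrib)
  note M0 = V.subspace_0[OF M] and Madd = V.subspace_add[OF M] and Mdiff = V.subspace_diff[OF M]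
    and Mscale = V.subspace_scale[OF M]
  have f0: "f 0 = 0" if "f \<in> lcarrier (gl s M)" for f
    using that M0 by (auto simp: gl_def dest!: bspec[of _ _ 0])
  have fdiff: "f (x - y) = f x - f y" if "f \<in> lcarrier (gl s M)" "x \<in> M" "y \<in> M" for f x y
  proof -
    have "\<forall>x\<in>M. \<forall>y\<in>M. f (x + y) = f x + f y" using that by (simp add: gl_def)
    then have "f ((x - y) + y) = f (x - y) + f y" using that Mdiff[of x y] by blast
    then show ?thesis by simp
  qed
  have fM: "f x \<in> M" if "f \<in> lcarrier (gl s M)" for f x
    using that M0 by (cases "x \<in> M") (auto simp: gl_def)
  have fadd: "f (x + y) = f x + f y" if "f \<in> lcarrier (gl s M)" "x \<in> M" "y \<in> M" for f x y
    using that by (simp add: gl_def)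
  have fscale: "f (s a x) = s a (f x)" if "f \<in> lcarrier (gl s M)" "x \<in> M" for f x a
    using that by (simp add: gl_def)
  have fout: "f x = 0" if "f \<in> lcarrier (gl s M)" "x \<notin> M" for f x
    using that by (simp add: gl_def)
  have br: "bracket (gl s M) f g = (\<lambda>x. f (g x) - g (f x))" for f g by (simp add: gl_def)
  have sc: "lscale (gl s M) a f = (\<lambda>x. s a (f x))" for a f by (simp add: gl_def)
  have I: "f \<in> lcarrier (gl s M)"
    if "\<And>x. x \<in> M \<Longrightarrow> f x \<in> M" "\<And>x y. x \<in> M \<Longrightarrow> y \<in> M \<Longrightarrow> f (x + y) = f x + f y"
      "\<And>a x. x \<in> M \<Longrightarrow> f (s a x) = s a (f x)" "\<And>x. x \<notin> M \<Longrightarrow> f x = 0" for f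
    using that by (auto simp: gl_def)
  show ?thesis
  proof
    show "L.subspace (lcarrier (gl s M))"
    proof (rule L.subspaceI)
      show "0 \<in> lcarrier (gl s M)" by (rule I) (simp_all add: M0)
      show "f + g \<in> lcarrier (gl s M)" if "f \<in> lcarrier (gl s M)" "g \<in> lcarrier (gl s M)" for f g
        by (rule I) (use that in \<open>simp_all add: fM Madd fadd fscale fout V.scale_right_distrib\<close>)
      show "lscale (gl s M) a f \<in> lcarrier (gl s M)" if "f \<in> lcarrier (gl s M)" for a f
        by (rule I) (use that in \<open>simp_all add: sc fM Mscale fadd fscale fout V.scale_right_distrib
            V.scale_scale mult.commute\<close>)
    qed
    show "bracket (gl s M) f g \<in> lcarrier (gl s M)"
      if "f \<in> lcarrier (gl s M)" "g \<in> lcarrier (gl s M)" for f g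
      by (rule I) (use that in \<open>simp_all add: br fM Mdiff fadd fscale fout f0 V.scale_right_diff_distrib\<close>)
  qed (auto simp: br sc fun_eq_iff fadd fdiff fscale fM V.scale_right_diff_distrib)
qed

lemma gl_antisym: "lie_sym (gl s M) f g = 0"
  by (simp add: lie_sym_def gl_def fun_eq_iff)

section \<open>Amalgams of Lie algebras\<close>

definition fun_scale :: "'k::field \<Rightarrow> ('b \<Rightarrow> 'k) \<Rightarrow> 'b \<Rightarrow> 'k" where
  "fun_scale a f = (\<lambda>w. a * f w)"

lemma vector_space_fun_scale: "vector_space fun_scale"
  by unfold_locales (auto simp: fun_scale_def fun_eq_iff algebra_simps)

text \<open>The letters in both alphabets label the subalgebra to be identified. Equality in
  \<open>agree\<close> also forces its closure: the coordinates of a bracket of two shared letters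
  are supported in \<open>SD\<close> and in \<open>SB\<close>.\<close>

locale lie_amalgam = D: lie_coordinates D SD eD cD + B: lie_coordinates B SB eB cB
  for D :: "('k::field, 'a::ab_group_add) leibniz" and SD :: "'b set" and eD cD
    and B :: "('k, 'c::ab_group_add) leibniz" and SB eB cB +
  assumes agree: "x \<in> SD \<inter> SB \<Longrightarrow> y \<in> SD \<inter> SB \<Longrightarrow>
    cD (bracket D (eD x) (eD y)) = cB (bracket B (eB x) (eB y))"
begin

definition structure_const :: "'b \<Rightarrow> 'b \<Rightarrow> 'b \<Rightarrow> 'k" where
  "structure_const x y z =
     (if x \<in> SD \<and> y \<in> SD then cD (bracket D (eD x) (eD y)) z
      else if x \<in> SB \<and> y \<in> SB then cB (bracket B (eB x) (eB y)) z else 0)"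

definition well_ord :: "'b rel" where
  "well_ord = (SOME r. well_order_on UNIV r)"

text \<open>Common letters come first, so that out-of-order neighbours \<open>x y\<close>, \<open>y z\<close> always lie
  in one common factor.\<close>

definition letter_less :: "'b \<Rightarrow> 'b \<Rightarrow> bool" where
  "letter_less x y \<longleftrightarrow> (x \<in> SD \<inter> SB \<and> y \<notin> SD \<inter> SB) \<or>
     ((x \<in> SD \<inter> SB \<longleftrightarrow> y \<in> SD \<inter> SB) \<and> (x, y) \<in> well_ord \<and> x \<noteq> y)"

lemma structure_const_D:
  "x \<in> SD \<Longrightarrow> y \<in> SD \<Longrightarrow> structure_const x y z = cD (bracket D (eD x) (eD y)) z"
  by (simp add: structure_const_def)

lemma structure_const_B:
  "x \<in> SB \<Longrightarrow> y \<in> SB \<Longrightarrow> structure_const x y z = cB (bracket B (eB x) (eB y)) z"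
  using agree[of x y] by (simp add: structure_const_def)

sublocale R: lie_rewriting "{SD, SB}" letter_less structure_const
proof
  have wo: "well_order_on UNIV well_ord"
    unfolding well_ord_def by (rule someI_ex) (rule well_order_on)
  then have tr: "trans well_ord" and an: "antisym well_ord" and to: "total well_ord"
    by (auto simp: well_order_on_def linear_order_on_def partial_order_on_def preorder_on_def)
  show "\<not> letter_less x x" for x by (simp add: letter_less_def)
  show "letter_less x y \<Longrightarrow> letter_less y z \<Longrightarrow> letter_less x z" for x y z
    using transD[OF tr, of x y z] antisymD[OF an, of x y] unfolding letter_less_def by metis
  show "x \<noteq> y \<Longrightarrow> letter_less x y \<or> letter_less y x" for x y
    using to unfolding letter_less_def total_on_def by blast
  show "finite {z. structure_const x y z \<noteq> 0}" for x y
  proof -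
    consider "x \<in> SD \<and> y \<in> SD" | "\<not> (x \<in> SD \<and> y \<in> SD)" "x \<in> SB \<and> y \<in> SB"
      | "\<not> (x \<in> SD \<and> y \<in> SD)" "\<not> (x \<in> SB \<and> y \<in> SB)" by blast
    then show ?thesis
    proof cases
      case 1
      then show ?thesis
        by (simp add: structure_const_def D.c_finite D.bracket_closed D.e_carrier)
    next
      case 2
      then show ?thesis
        by (simp add: structure_const_def B.c_finite B.bracket_closed B.e_carrier)
    next
      case 3
      then show ?thesis by (simp add: structure_const_def)
    qed
  qed
  show "structure_const x y z = - structure_const y x z" for x y z
    using D.c_bracket_anti[OF D.e_carrier D.e_carrier, of x y]
      B.c_bracket_anti[OF B.e_carrier B.e_carrier, of x y]
    by (simp add: structure_const_def)
  show "structure_const x x z = 0" for x z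
    by (simp add: structure_const_def D.c_bracket_alt B.c_bracket_alt D.e_carrier B.e_carrier)
  show "z \<in> T" if "T \<in> {SD, SB}" "x \<in> T" "y \<in> T" "structure_const x y z \<noteq> 0" for T x y z
    using that structure_const_D[of x y z] structure_const_B[of x y z]
      D.c_support[OF D.bracket_closed[OF D.e_carrier D.e_carrier], of x y z]
      B.c_support[OF B.bracket_closed[OF B.e_carrier B.e_carrier], of x y z]
    by auto
  \<comment> \<open>If y is shared, so is the smaller letter z, and the side \<open>S\<close>
    contains all three. Otherwise y lies in one side only, and \<open>S = S'\<close>.\<close>
  show "\<exists>T\<in>{SD, SB}. x \<in> T \<and> y \<in> T \<and> z \<in> T"
    if "letter_less z y" "letter_less y x" "S \<in> {SD, SB}" "x \<in> S" "y \<in> S"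
      "S' \<in> {SD, SB}" "y \<in> S'" "z \<in> S'" for x y z S S'
    using that unfolding letter_less_def by auto
  show "(\<Sum>c | structure_const y z c \<noteq> 0. structure_const y z c * structure_const c x a)
      - (\<Sum>c | structure_const x z c \<noteq> 0. structure_const x z c * structure_const c y a)
      + (\<Sum>c | structure_const x y c \<noteq> 0. structure_const x y c * structure_const c z a) = 0"
    if T: "T \<in> {SD, SB}" and xyz: "x \<in> T" "y \<in> T" "z \<in> T" for T x y z a
  proof -
    consider "T = SD" | "T = SB" using T by blast
    then show ?thesis
    proof cases
      case 1
      have "(\<Sum>c | structure_const p q c \<noteq> 0. structure_const p q c * structure_const c r a) =
          cD (bracket D (bracket D (eD p) (eD q)) (eD r)) a" if "p \<in> SD" "q \<in> SD" "r \<in> SD" for p q r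
      proof -
        have b: "bracket D (eD p) (eD q) \<in> lcarrier D"
          using that by (simp add: D.bracket_closed D.e_carrier)
        have "structure_const c r a = cD (bracket D (eD c) (eD r)) a"
          if "cD (bracket D (eD p) (eD q)) c \<noteq> 0" for c
          using D.c_support[OF b that] structure_const_D \<open>r \<in> SD\<close> by blast
        then show ?thesis
          using that D.c_bracket_expand_left[OF b D.e_carrier[of r]] by (simp add: structure_const_D)
      qed
      then show ?thesis using xyz 1 D.c_jacobi by (simp add: D.e_carrier)
    next
      case 2
      have "(\<Sum>c | structure_const p q c \<noteq> 0. structure_const p q c * structure_const c r a) =
          cB (bracket B (bracket B (eB p) (eB q)) (eB r)) a" if "p \<in> SB" "q \<in> SB" "r \<in> SB" for p q r
      proof -
        have b: "bracket B (eB p) (eB q) \<in> lcarrier B"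
          using that by (simp add: B.bracket_closed B.e_carrier)
        have "structure_const c r a = cB (bracket B (eB c) (eB r)) a"
          if "cB (bracket B (eB p) (eB q)) c \<noteq> 0" for c
          using B.c_support[OF b that] structure_const_B \<open>r \<in> SB\<close> by blast
        then show ?thesis
          using that B.c_bracket_expand_left[OF b B.e_carrier[of r]] by (simp add: structure_const_B)
      qed
      then show ?thesis using xyz 2 B.c_jacobi by (simp add: B.e_carrier)
    qed
  qed
qed

text \<open>The transpose of right multiplication, (u f)(w) = f(w u). Appending at the end makes
  this a left action, (u v) f = u (v f), so brackets go to commutators without a sign.\<close>

definition act :: "('b \<Rightarrow> 'k) \<Rightarrow> ('b list \<Rightarrow> 'k) \<Rightarrow> 'b list \<Rightarrow> 'k" where
  "act u f = (if f \<in> R.admissible then (\<lambda>w. \<Sum>x | u x \<noteq> 0. u x * f (w @ [x])) else 0)"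

definition envelope :: "('k, ('b list \<Rightarrow> 'k) \<Rightarrow> 'b list \<Rightarrow> 'k) leibniz" where
  "envelope = gl fun_scale R.admissible"

lemma admissible_subspace: "module.subspace fun_scale R.admissible"
proof -
  interpret vector_space fun_scale by (rule vector_space_fun_scale)
  show ?thesis
    by (rule subspaceI)
      (auto simp: R.admissible_def R.subst_sum_def fun_scale_def algebra_simps sum.distrib sum_distrib_left)
qed

lemma leibniz_algebra_envelope: "leibniz_algebra envelope"
  unfolding envelope_def by (rule leibniz_algebra_gl[OF vector_space_fun_scale admissible_subspace])

lemma act_superset:
  assumes "f \<in> R.admissible" "finite F" "{x. u x \<noteq> 0} \<subseteq> F"
  shows "act u f w = (\<Sum>x\<in>F. u x * f (w @ [x]))"
  using assms by (simp add: act_def) (rule sum.mono_neutral_left, auto)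

text \<open>A letter appended at the end leaves every pair y z inside the word in place, so the
  relations for the translated functional are instances of those for \<open>f\<close>.\<close>

lemma act_admissible:
  assumes f: "f \<in> R.admissible"
  shows "act u f \<in> R.admissible"
proof -
  have "(\<lambda>w. f (w @ [x])) \<in> R.admissible" for x
    using f by (simp add: R.admissible_def R.subst_sum_def)
  note this[unfolded R.admissible_def mem_Collect_eq, rule_format]
  then have "f (a @ y # z # b @ [x]) = f (a @ z # y # b @ [x]) + R.subst_sum (\<lambda>w. f (w @ [x])) a (structure_const y z) b"
    if "R.compat y z" for a y z b x using that by simp
  then show ?thesis
    using f by (auto simp: act_def R.admissible_def R.subst_sum_def sum.distrib distrib_left
        sum_distrib_left mult.left_commute intro: sum.swap)
qed

lemma act_envelope: "act u \<in> lcarrier envelope"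
proof -
  interpret V: vector_space fun_scale by (rule vector_space_fun_scale)
  show ?thesis
    using act_admissible V.subspace_add[OF admissible_subspace] V.subspace_scale[OF admissible_subspace]
    by (auto simp: envelope_def gl_def act_def fun_scale_def fun_eq_iff distrib_left sum.distrib
        sum_distrib_left mult.left_commute)
qed

lemma act_add:
  assumes "finite {x. u x \<noteq> 0}" "finite {x. v x \<noteq> 0}"
  shows "act (\<lambda>x. u x + v x) = act u + act v"
proof (intro ext)
  fix f w
  show "act (\<lambda>x. u x + v x) f w = (act u + act v) f w"
  proof (cases "f \<in> R.admissible")
    case True
    let ?F = "{x. u x \<noteq> 0} \<union> {x. v x \<noteq> 0}"
    have F: "finite ?F" using assms by simp
    have "act (\<lambda>x. u x + v x) f w = (\<Sum>x\<in>?F. (u x + v x) * f (w @ [x]))"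
      "act u f w = (\<Sum>x\<in>?F. u x * f (w @ [x]))" "act v f w = (\<Sum>x\<in>?F. v x * f (w @ [x]))"
      by (rule act_superset[OF True F]; auto)+
    then show ?thesis by (simp add: distrib_right sum.distrib)
  qed (simp add: act_def)
qed

lemma act_scale: "act (\<lambda>x. a * u x) = lscale envelope a (act u)"
  by (cases "a = 0")
    (auto simp: act_def envelope_def gl_def fun_scale_def fun_eq_iff sum_distrib_left mult.assoc)

text \<open>Admissibility applied to the last two letters replaces f(w x y) - f(w y x) by f(w
  [x,y]). The function \<open>t\<close> stands for the coordinates of [u,v], so that the lemma
  serves both factors.\<close>

lemma act_bracket:
  assumes T: "T \<in> {SD, SB}"
    and u: "finite {x. u x \<noteq> 0}" "{x. u x \<noteq> 0} \<subseteq> T" and v: "finite {x. v x \<noteq> 0}" "{x. v x \<noteq> 0} \<subseteq> T"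
    and t: "\<And>z. t z = (\<Sum>x | u x \<noteq> 0. \<Sum>y | v y \<noteq> 0. u x * v y * structure_const x y z)"
  shows "act t = bracket envelope (act u) (act v)"
proof (intro ext)
  fix f w
  show "act t f w = bracket envelope (act u) (act v) f w"
  proof (cases "f \<in> R.admissible")
    case f: True
    let ?U = "{x. u x \<noteq> 0}" and ?V = "{x. v x \<noteq> 0}"
    let ?Z = "\<Union>x\<in>?U. \<Union>y\<in>?V. {z. structure_const x y z \<noteq> 0}"
    have Z: "finite ?Z" using u v R.finite_supp by blast
    have tZ: "{z. t z \<noteq> 0} \<subseteq> ?Z"
    proof (rule ccontr)
      assume "\<not> {z. t z \<noteq> 0} \<subseteq> ?Z"
      then obtain z where z: "t z \<noteq> 0" "z \<notin> ?Z" by blast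
      have "t z = 0" unfolding t using z(2) by (intro sum.neutral ballI) auto
      then show False using z(1) by simp
    qed
    have "bracket envelope (act u) (act v) f w =
        (\<Sum>x\<in>?U. \<Sum>y\<in>?V. u x * v y * f (w @ [x, y])) - (\<Sum>y\<in>?V. \<Sum>x\<in>?U. u x * v y * f (w @ [y, x]))"
      using f act_admissible[OF f, of u] act_admissible[OF f, of v]
      by (simp add: envelope_def gl_def act_def[of _ "act _ _"])
        (simp add: act_def sum_distrib_left mult.assoc mult.left_commute)
    also have "\<dots> = (\<Sum>x\<in>?U. \<Sum>y\<in>?V. u x * v y * (f (w @ [x, y]) - f (w @ [y, x])))"
      by (subst sum.swap[of _ ?U ?V]) (simp add: sum_subtractf right_diff_distrib)
    also have "\<dots> = (\<Sum>x\<in>?U. \<Sum>y\<in>?V. u x * v y * (\<Sum>z\<in>?Z. structure_const x y z * f (w @ [z])))"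
    proof (intro sum.cong refl)
      fix x y assume xy: "x \<in> ?U" "y \<in> ?V"
      then have "R.compat x y" using T u v by (auto simp: R.compat_def)
      then have "f (w @ [x, y]) - f (w @ [y, x]) = R.subst_sum f w (structure_const x y) []"
        using f by (simp add: R.admissible_def)
      also have "\<dots> = (\<Sum>z\<in>?Z. structure_const x y z * f (w @ [z]))"
        using R.subst_sum_superset[OF Z, of "structure_const x y"] xy by blast
      finally show "u x * v y * (f (w @ [x, y]) - f (w @ [y, x])) =
        u x * v y * (\<Sum>z\<in>?Z. structure_const x y z * f (w @ [z]))" by simp
    qed
    also have "\<dots> = (\<Sum>z\<in>?Z. t z * f (w @ [z]))"
      unfolding t sum_distrib_left sum_distrib_right sum.swap[of _ ?Z] by (simp add: mult.assoc)
    also have "\<dots> = act t f w" using act_superset[OF f Z tZ] by simp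
    finally show ?thesis by simp
  qed (simp add: act_def envelope_def gl_def)
qed

text \<open>Faithfulness: at the empty word, the functional of \<open>admissible_point\<close> reads
  off the coefficient \<open>u x\<close>.\<close>

lemma act_eq_zero:
  assumes u: "finite {x. u x \<noteq> 0}" and "act u = 0"
  shows "u x = 0"
proof -
  obtain f where f: "f \<in> R.admissible" "\<And>y. f [y] = (if y = x then 1 else 0)"
    using R.admissible_point by metis
  have "act u f [] = (\<Sum>y\<in>insert x {y. u y \<noteq> 0}. u y * f ([] @ [y]))"
    using act_superset[OF f(1), of "insert x {y. u y \<noteq> 0}"] u by blast
  also have "\<dots> = (\<Sum>y\<in>insert x {y. u y \<noteq> 0}. if y = x then u x else 0)"
    using f(2) by (intro sum.cong) auto
  finally show ?thesis using u assms(2) by simp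
qed

lemma act_hom_D: "leibniz_hom D envelope (\<lambda>v. act (cD v))"
proof (rule leibniz_homI)
  fix v w assume vw: "v \<in> lcarrier D" "w \<in> lcarrier D"
  show "act (cD (v + w)) = act (cD v) + act (cD w)"
  proof -
    have "cD (v + w) = (\<lambda>x. cD v x + cD w x)" using vw by (simp add: fun_eq_iff D.c_add)
    then show ?thesis using vw act_add[OF D.c_finite D.c_finite, of v w] by simp
  qed
  have "cD (bracket D v w) z =
      (\<Sum>x | cD v x \<noteq> 0. \<Sum>y | cD w y \<noteq> 0. cD v x * cD w y * structure_const x y z)" for z
    unfolding D.c_bracket[OF vw] using vw D.c_support
    by (intro sum.cong refl) (metis (mono_tags, lifting) mem_Collect_eq structure_const_D)
  then show "act (cD (bracket D v w)) = bracket envelope (act (cD v)) (act (cD w))"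
    by (intro act_bracket[of SD]) (use vw D.c_finite D.c_support in blast)+
next
  fix a v assume v: "v \<in> lcarrier D"
  then have "cD (lscale D a v) = (\<lambda>x. a * cD v x)" by (simp add: fun_eq_iff D.c_scale)
  then show "act (cD (lscale D a v)) = lscale envelope a (act (cD v))" by (simp add: act_scale)
qed (rule act_envelope)

lemma act_hom_B: "leibniz_hom B envelope (\<lambda>v. act (cB v))"
proof (rule leibniz_homI)
  fix v w assume vw: "v \<in> lcarrier B" "w \<in> lcarrier B"
  show "act (cB (v + w)) = act (cB v) + act (cB w)"
  proof -
    have "cB (v + w) = (\<lambda>x. cB v x + cB w x)" using vw by (simp add: fun_eq_iff B.c_add)
    then show ?thesis using vw act_add[OF B.c_finite B.c_finite, of v w] by simp
  qed
  have "cB (bracket B v w) z =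
      (\<Sum>x | cB v x \<noteq> 0. \<Sum>y | cB w y \<noteq> 0. cB v x * cB w y * structure_const x y z)" for z
    unfolding B.c_bracket[OF vw] using vw B.c_support
    by (intro sum.cong refl) (metis (mono_tags, lifting) mem_Collect_eq structure_const_B)
  then show "act (cB (bracket B v w)) = bracket envelope (act (cB v)) (act (cB w))"
    by (intro act_bracket[of SB]) (use vw B.c_finite B.c_support in blast)+
next
  fix a v assume v: "v \<in> lcarrier B"
  then have "cB (lscale B a v) = (\<lambda>x. a * cB v x)" by (simp add: fun_eq_iff B.c_scale)
  then show "act (cB (lscale B a v)) = lscale envelope a (act (cB v))" by (simp add: act_scale)
qed (rule act_envelope)

lemma act_kernel_D: "v \<in> lcarrier D \<Longrightarrow> act (cD v) = 0 \<Longrightarrow> v \<in> lie_derived D"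
  using act_eq_zero[OF D.c_finite] D.c_kernel by blast

lemma act_kernel_B: "v \<in> lcarrier B \<Longrightarrow> act (cB v) = 0 \<Longrightarrow> v \<in> lie_derived B"
  using act_eq_zero[OF B.c_finite] B.c_kernel by blast

lemma envelope_antisym: "lie_sym envelope f g = 0"
  unfolding envelope_def by (rule gl_antisym)

end

text \<open>The amalgam acts on linear functionals on words, so that the Poincare--Birkhoff--Witt theorem is only
  needed as an extension property of functionals.\<close>

theorem lie_amalgam_exists:
  fixes D :: "('k::field, 'a::ab_group_add) leibniz" and B :: "('k, 'c::ab_group_add) leibniz"
  assumes two: "(2::'k) \<noteq> 0" and D: "leibniz_algebra D" and B: "leibniz_algebra B"
    and i: "Vector_Spaces.linear (lscale D) (lscale B) i"
    and N: "module.subspace (lscale D) N" "N \<subseteq> lcarrier D" "i ` N \<subseteq> lcarrier B" "inj_on i N"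
    and closed: "\<And>x y. x \<in> N \<Longrightarrow> y \<in> N \<Longrightarrow> bracket D x y \<in> N"
    and hom: "\<And>x y. x \<in> N \<Longrightarrow> y \<in> N \<Longrightarrow> i (bracket D x y) = bracket B (i x) (i y)"
    and ND: "N \<inter> lie_derived D = {0}" and NB: "i ` N \<inter> lie_derived B = {0}"
  obtains Y :: "('k, (('a + 'c) list \<Rightarrow> 'k) \<Rightarrow> ('a + 'c) list \<Rightarrow> 'k) leibniz" and f g
  where "leibniz_algebra Y" "\<And>u v. lie_sym Y u v = 0"
    "leibniz_hom D Y f" "leibniz_hom B Y g" "\<And>x. x \<in> N \<Longrightarrow> f x = g (i x)"
    "\<And>x. x \<in> lcarrier D \<Longrightarrow> f x = 0 \<Longrightarrow> x \<in> lie_derived D"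
    "\<And>x. x \<in> lcarrier B \<Longrightarrow> g x = 0 \<Longrightarrow> x \<in> lie_derived B"
proof -
  interpret D: leibniz_algebra D by fact
  interpret B: leibniz_algebra B by fact
  interpret i: Vector_Spaces.linear "lscale D" "lscale B" i by fact
  obtain b where b: "b \<subseteq> N" "D.independent b" "N \<subseteq> D.span b"
    using D.maximal_independent_subset by metis
  have sb: "D.span b = N" using b N(1) D.span_minimal by blast
  have ib: "B.independent (i ` b)"
    using i.independent_injective_image[OF b(2)] sb N(4) by simp
  have sib: "B.span (i ` b) = i ` N" using i.span_image[of b] sb by simp
  have "b \<subseteq> lcarrier D" "D.span b \<inter> lie_derived D = {0}" using b N ND sb by auto
  then obtain S c where S: "b \<subseteq> S" "lie_coordinates D S (\<lambda>x. x) c"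
    using D.lie_coordinates_exist[OF two _ b(2)] by metis
  have "i ` b \<subseteq> lcarrier B" "B.span (i ` b) \<inter> lie_derived B = {0}"
    using subset_trans[OF image_mono[OF b(1)] N(3)] NB sib by simp_all
  then obtain S' c' where S': "i ` b \<subseteq> S'" "lie_coordinates B S' (\<lambda>x. x) c'"
    using B.lie_coordinates_exist[OF two _ ib] by metis
  define l where "l y = (if y \<in> i ` b then Inl (inv_into b i y) else Inr y)" for y
  have inj: "inj_on i b" using b N inj_on_subset by blast
  have l: "inj_on l S'"
    by (rule inj_onI) (auto simp: l_def split: if_splits dest: inv_into_injective)
  have li: "l (i x) = Inl x" if "x \<in> b" for x using that inj by (simp add: l_def)
  interpret C: lie_coordinates D S "\<lambda>x. x" c by (rule S(2))
  interpret C': lie_coordinates B S' "\<lambda>x. x" c' by (rule S'(2))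
  define cD :: "'a \<Rightarrow> 'a + 'c \<Rightarrow> 'k" where "cD = (\<lambda>v y. if y \<in> Inl ` S then c v (inv_into S Inl y) else 0)"
  define cB :: "'c \<Rightarrow> 'a + 'c \<Rightarrow> 'k" where "cB = (\<lambda>v y. if y \<in> l ` S' then c' v (inv_into S' l y) else 0)"
  interpret P: lie_coordinates D "Inl ` S" "inv_into S Inl" cD
    unfolding cD_def using C.relabel[of Inl] by simp
  interpret Q: lie_coordinates B "l ` S'" "inv_into S' l" cB
    unfolding cB_def using C'.relabel[OF l] .
  have eb: "inv_into S Inl (Inl x :: 'a + 'c) = x" "inv_into S' l (Inl x) = i x"
      "(Inl x :: 'a + 'c) \<in> Inl ` S" "Inl x \<in> l ` S'"
    if "x \<in> b" for x
  proof -
    have x: "x \<in> S" "i x \<in> S'" using that S S' by auto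
    then show "inv_into S Inl (Inl x :: 'a + 'c) = x" "(Inl x :: 'a + 'c) \<in> Inl ` S" by simp_all
    show "inv_into S' l (Inl x) = i x" "Inl x \<in> l ` S'"
      unfolding li[OF that, symmetric] using x l by simp_all
  qed
  \<comment> \<open>Both coordinate functions of a vector in \<open>b\<close> are the indicator of
    the same letter, and linearity extends this to \<open>N\<close>. As \<open>N\<close> is closed
    under the bracket, it applies to brackets of shared letters, as \<open>agree\<close>
    demands.\<close>
  have c_agree: "cD v = cB (i v)" if "v \<in> N" for v
  proof -
    have "D.span b \<subseteq> {v \<in> N. cD v = cB (i v)}"
    proof (rule D.span_minimal)
      show "b \<subseteq> {v \<in> N. cD v = cB (i v)}"
      proof
        fix x assume x: "x \<in> b"
        have "cD x y = cB (i x) y" for y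
          using P.c_e[OF eb(3)[OF x], of y] Q.c_e[OF eb(4)[OF x], of y] eb(1,2)[OF x] by simp
        then show "x \<in> {v \<in> N. cD v = cB (i v)}" using b x by auto
      qed
      show "D.subspace {v \<in> N. cD v = cB (i v)}"
      proof (rule D.subspaceI)
        show "0 \<in> {v \<in> N. cD v = cB (i v)}"
          using D.subspace_0[OF N(1)] P.c_scale[of 0 0] Q.c_scale[of 0 0] by (simp add: i.zero fun_eq_iff)
        show "x + y \<in> {v \<in> N. cD v = cB (i v)}"
          if "x \<in> {v \<in> N. cD v = cB (i v)}" "y \<in> {v \<in> N. cD v = cB (i v)}" for x y
          using that N D.subspace_add[OF N(1)] by (auto simp: i.add fun_eq_iff P.c_add Q.c_add subset_iff)
        show "lscale D a x \<in> {v \<in> N. cD v = cB (i v)}"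
          if "x \<in> {v \<in> N. cD v = cB (i v)}" for a x
          using that N D.subspace_scale[OF N(1)] by (auto simp: i.scale fun_eq_iff P.c_scale Q.c_scale subset_iff)
      qed
    qed
    then show ?thesis using that sb by blast
  qed
  interpret A: lie_amalgam D "Inl ` S" "inv_into S Inl" cD B "l ` S'" "inv_into S' l" cB
  proof
    fix x y assume "x \<in> Inl ` S \<inter> l ` S'" "y \<in> Inl ` S \<inter> l ` S'"
    then obtain x' y' where xy: "x' \<in> b" "x = Inl x'" "y' \<in> b" "y = Inl y'"
      using inj by (auto simp: l_def split: if_splits)
    then show "cD (bracket D (inv_into S Inl x) (inv_into S Inl y)) =
        cB (bracket B (inv_into S' l x) (inv_into S' l y))"
      using b c_agree[OF closed, of x' y'] hom[of x' y'] by (simp add: eb subset_iff)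
  qed
  show ?thesis
    by (rule that[OF A.leibniz_algebra_envelope A.envelope_antisym A.act_hom_D A.act_hom_B
          _ A.act_kernel_D A.act_kernel_B]) (simp_all add: c_agree)
qed

section \<open>Extensions by kernels and transport to words\<close>

definition kernel_ext ::
  "('k::field, 'h::ab_group_add) leibniz \<Rightarrow> ('k, 'q::ab_group_add) leibniz \<Rightarrow> ('h \<Rightarrow> 'q) \<Rightarrow>
    ('k, 'h, 'h, 'q) leibniz_ext" where
  "kernel_ext H Q p = \<lparr>ext_ker = H\<lparr>lcarrier := {x \<in> lcarrier H. p x = 0}\<rparr>, ext_mid = H,
     ext_quo = Q, ext_inc = (\<lambda>x. x), ext_proj = p\<rparr>"

lemma kernel_ext_simps [simp]:
  "ext_mid (kernel_ext H Q p) = H" "ext_quo (kernel_ext H Q p) = Q" "ext_proj (kernel_ext H Q p) = p"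
  by (simp_all add: kernel_ext_def)

lemma kernel_ext_central:
  assumes H: "leibniz_algebra H" and Q: "leibniz_algebra Q" and p: "leibniz_hom H Q p"
    and onto: "p ` lcarrier H = lcarrier Q"
    and central: "\<And>x y. x \<in> lcarrier H \<Longrightarrow> p x = 0 \<Longrightarrow> y \<in> lcarrier H \<Longrightarrow> lie_sym H x y = 0"
  shows "lie_central_extension (kernel_ext H Q p)"
proof -
  interpret H: leibniz_algebra H by fact
  interpret Q: leibniz_algebra Q by fact
  note h = leibniz_homD[OF p] H.hom_zero[OF p]
  have "leibniz_algebra (H\<lparr>lcarrier := {x \<in> lcarrier H. p x = 0}\<rparr>)"
    by (rule H.subalgebra)
      (auto simp: h H.carrier_closed Q.scale_zero_right intro!: H.subspaceI)
  then show ?thesis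
    using assms by (intro lie_central_extensionI) (auto simp: kernel_ext_def leibniz_hom_def)
qed

text \<open>Injectivity on the commutator ideal, the criterion of \<open>lie_isoclinic_homI\<close>,
  is inherited from injectivity on the whole algebra.\<close>

lemma kernel_ext_mono:
  assumes E: "lie_central_extension E" and K: "lie_central_extension (kernel_ext H Q p)"
    and hom: "leibniz_hom (ext_mid E) H \<beta>" and iso: "leibniz_iso (ext_quo E) Q \<gamma>"
    and proj: "\<And>x. x \<in> lcarrier (ext_mid E) \<Longrightarrow> p (\<beta> x) = \<gamma> (ext_proj E x)"
    and inj: "\<And>x. x \<in> lcarrier (ext_mid E) \<Longrightarrow> \<beta> x = 0 \<Longrightarrow> x = 0"
  shows "lie_isoclinic_mono E (kernel_ext H Q p) (\<lambda>n. \<beta> (ext_inc E n)) \<beta> \<gamma>"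
  unfolding lie_isoclinic_mono_def
proof
  interpret G: leibniz_algebra "ext_mid E" using lie_central_extensionD[OF E] by auto
  interpret Q: leibniz_algebra "ext_quo E" using lie_central_extensionD[OF E] by auto
  note D = lie_central_extensionD[OF E]
  show "inj_on \<beta> (lcarrier (ext_mid E))" by (rule G.hom_inj_on[OF hom inj])
  have g: "leibniz_hom (ext_quo E) Q \<gamma>" using iso by (simp add: leibniz_iso_def)
  have inc: "ext_inc E n \<in> lcarrier (ext_mid E)" "ext_proj E (ext_inc E n) = 0"
    if "n \<in> lcarrier (ext_ker E)" for n using D(7) that by blast+
  have "ext_hom E (kernel_ext H Q p) (\<lambda>n. \<beta> (ext_inc E n)) \<beta> \<gamma>"
    unfolding ext_hom_def
  proof (intro conjI ballI)
    show "leibniz_hom (ext_ker E) (ext_ker (kernel_ext H Q p)) (\<lambda>n. \<beta> (ext_inc E n))"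
      using leibniz_homD[OF D(4)] leibniz_homD[OF hom]
      by (auto simp: kernel_ext_def inc proj Q.hom_zero[OF g] intro!: leibniz_homI)
  qed (use hom g proj in \<open>auto simp: kernel_ext_def\<close>)
  then show "lie_isoclinic_hom E (kernel_ext H Q p) (\<lambda>n. \<beta> (ext_inc E n)) \<beta> \<gamma>"
    by (rule lie_isoclinic_homI[OF E K]) (use iso inj G.lie_derived_carrier in auto)
qed

section \<open>Subalgebras spanned by left-normed words\<close>

context leibniz_algebra
begin

text \<open>The list x1, ..., xn stands for the left-normed product [...[xn, x(n-1)], ..., x1], so
  that putting a letter in front is right bracketing with a generator.\<close>

fun word :: "('x \<Rightarrow> 'a) \<Rightarrow> 'x list \<Rightarrow> 'a" where
  "word g [] = 0"
| "word g [x] = g x"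
| "word g (x # y # w) = bracket G (word g (y # w)) (g x)"

lemma word_carrier: "(\<And>x. g x \<in> lcarrier G) \<Longrightarrow> word g w \<in> lcarrier G"
  by (induction g w rule: word.induct) (auto simp: bracket_closed)

text \<open>The Leibniz identity rewrites a bracket of left-normed words into left-normed words.\<close>

lemma word_span_closed:
  assumes g: "\<And>x. g x \<in> lcarrier G"
    and u: "u \<in> span (range (word g))" and v: "v \<in> span (range (word g))"
  shows "bracket G u v \<in> span (range (word g))"
proof -
  let ?S = "span (range (word g))"
  have S: "?S \<subseteq> lcarrier G"
    by (rule span_minimal) (auto simp: word_carrier g subspace_carrier)
  have gen: "bracket G u (g x) \<in> ?S" if "u \<in> ?S" for u x
  proof -
    have "?S \<subseteq> {u \<in> lcarrier G. bracket G u (g x) \<in> ?S}"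
    proof (rule span_minimal)
      have "bracket G (word g w) (g x) \<in> ?S" for w
      proof (cases w)
        case Nil
        then show ?thesis by (simp add: g span_zero)
      next
        case (Cons y w')
        then show ?thesis using span_base[OF rangeI, of "word g" "x # w"] by simp
      qed
      then show "range (word g) \<subseteq> {u \<in> lcarrier G. bracket G u (g x) \<in> ?S}"
        by (auto simp: word_carrier g)
    qed (auto simp: g carrier_closed bracket_add_left bracket_scale_left span_zero span_add span_scale
        intro!: subspaceI)
    then show ?thesis using that by auto
  qed
  \<comment> \<open>The claim quantifies over all \<open>u\<close> because the Leibniz identity
    calls the induction hypothesis for \<open>w\<close> also with \<open>bracket G u (g x)\<close>
    in place of \<open>u\<close>.\<close>
  have words: "\<forall>u\<in>?S. bracket G u (word g w) \<in> ?S" for w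
  proof (induction w)
    case Nil
    then show ?case using S by (auto simp: span_zero)
  next
    case (Cons x w)
    show ?case
    proof (cases w)
      case Nil
      then show ?thesis using gen by simp
    next
      case (Cons y w')
      have "bracket G u (word g (x # w)) \<in> ?S" if u: "u \<in> ?S" for u
      proof -
        have "bracket G u (word g (x # w)) =
            bracket G (bracket G u (word g w)) (g x) - bracket G (bracket G u (g x)) (word g w)"
          using S u g word_carrier[of g w] by (simp add: Cons) (rule leibniz_identity, auto)
        then show ?thesis using u Cons.IH gen by (auto intro!: span_diff)
      qed
      then show ?thesis by blast
    qed
  qed
  have "?S \<subseteq> {v \<in> lcarrier G. bracket G u v \<in> ?S}"
    using u S words
    by (intro span_minimal)
      (auto simp: word_carrier g carrier_closed bracket_add_right bracket_scale_right span_zero span_add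
        span_scale intro!: subspaceI dest!: subsetD[of _ "lcarrier G"])
  then show ?thesis using v by auto
qed

text \<open>With a basis \<open>B\<close> chosen among the words, a vector is encoded by the
  function sending a word to its \<open>B\<close>-coordinate at the value of that word. This is
  injective since every element of \<open>B\<close> is the value of some word.\<close>

lemma transport_to_words:
  fixes g :: "'x \<Rightarrow> 'a"
  assumes g: "\<And>x. g x \<in> lcarrier G"
  obtains S and K :: "('k, 'x list \<Rightarrow> 'k) leibniz" and T
  where "leibniz_algebra (G\<lparr>lcarrier := S\<rparr>)" "S \<subseteq> lcarrier G" "\<And>x. g x \<in> S"
    "leibniz_algebra K" "leibniz_iso (G\<lparr>lcarrier := S\<rparr>) K T"
proof -
  let ?S = "span (range (word g))" and ?H = "G\<lparr>lcarrier := span (range (word g))\<rparr>"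
  obtain B where B: "B \<subseteq> range (word g)" "independent B" "range (word g) \<subseteq> span B"
    using maximal_independent_subset by metis
  have SB: "?S = span B" using B span_minimal[OF B(3)] span_mono[OF B(1)] by auto
  have S: "?S \<subseteq> lcarrier G"
    by (rule span_minimal) (auto simp: word_carrier g subspace_carrier)
  have H: "leibniz_algebra ?H" by (rule subalgebra) (use S word_span_closed[of g] g in auto)
  define T where "T v = (\<lambda>w. representation B v (word g w))" for v
  have T0: "v = 0" if v: "v \<in> ?S" "T v = 0" for v
  proof -
    have "representation B v b = 0" for b
    proof (cases "b \<in> B")
      case True
      then obtain w where "b = word g w" using B(1) by blast
      then show ?thesis using fun_cong[OF that(2), of w] by (simp add: T_def)
    next
      case False
      then show ?thesis using representation_ne_zero by blast
    qed
    then show ?thesis using sum_nonzero_representation_eq[OF B(2), of v] v(1) SB by simp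
  qed
  have Tadd: "T (x + y) = T x + T y" if "x \<in> ?S" "y \<in> ?S" for x y
    using that representation_add[OF B(2), of y x] SB by (simp add: T_def fun_eq_iff)
  have Tscale: "T (lscale G a x) = fun_scale a (T x)" if "x \<in> ?S" for a x
    using that representation_scale[OF B(2), of x a] SB by (simp add: T_def fun_eq_iff fun_scale_def)
  interpret H: leibniz_algebra ?H by fact
  have K: "leibniz_algebra (image_leibniz fun_scale T ?H)" "leibniz_hom ?H (image_leibniz fun_scale T ?H) T"
  proof (rule_tac [!] image_leibniz[OF H vector_space_fun_scale])
    have z: "T 0 = 0" by (simp add: T_def representation_zero fun_eq_iff)
    show "T (bracket ?H x y) = 0 \<and> T (bracket ?H y x) = 0"
      if "x \<in> lcarrier ?H" "T x = 0" "y \<in> lcarrier ?H" for x y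
      using T0[of x] that S z by (auto simp: subset_iff)
    then show "T (bracket ?H x y) = 0 \<and> T (bracket ?H y x) = 0"
      if "x \<in> lcarrier ?H" "T x = 0" "y \<in> lcarrier ?H" for x y using that .
  qed (simp_all add: Tadd Tscale)
  have "inj_on T (lcarrier ?H)" by (rule H.hom_inj_on[OF K(2)]) (simp add: T0)
  then have "leibniz_iso ?H (image_leibniz fun_scale T ?H) T"
    using K(2) by (simp add: leibniz_iso_def bij_betw_def image_leibniz_def)
  moreover have "g x \<in> ?S" for x using span_base[OF rangeI, of "word g" "[x]"] by simp
  ultimately show ?thesis using that H S K(1) by blast
qed

end

context isoclinic_pair
begin

text \<open>Only the subalgebra generated by the images of \<open>g1\<close> and \<open>g2\<close> matters, and it has at most
  as many dimensions as there are words in these generators.\<close>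

lemma common_monos_transport:
  fixes H :: "('k, 'h::ab_group_add) leibniz"
  assumes H: "leibniz_algebra H" and p: "leibniz_hom H (ext_quo E1) p"
    and central: "\<And>x y. x \<in> lcarrier H \<Longrightarrow> p x = 0 \<Longrightarrow> y \<in> lcarrier H \<Longrightarrow> lie_sym H x y = 0"
    and b1: "leibniz_hom g1 H b1" "\<And>x. x \<in> lcarrier g1 \<Longrightarrow> b1 x = 0 \<Longrightarrow> x = 0"
      "\<And>x. x \<in> lcarrier g1 \<Longrightarrow> p (b1 x) = p1 x"
    and b2: "leibniz_hom g2 H b2" "\<And>x. x \<in> lcarrier g2 \<Longrightarrow> b2 x = 0 \<Longrightarrow> x = 0"
      "\<And>x. x \<in> lcarrier g2 \<Longrightarrow> p (b2 x) = \<gamma> (p2 x)"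
    and \<gamma>: "leibniz_iso (ext_quo E2) (ext_quo E1) \<gamma>"
  shows "\<exists>E :: ('k, ('g1 + 'g2) list \<Rightarrow> 'k, ('g1 + 'g2) list \<Rightarrow> 'k, 'q1) leibniz_ext.
    isoclinic_monos_into E E1 E2"
proof -
  interpret H: leibniz_algebra H by fact
  note D1 = lie_central_extensionD[OF E1]
  \<comment> \<open>The type of labels is the whole sum type, so elements outside the carriers are
    sent to 0 to keep all values in \<open>H\<close>.\<close>
  define g where "g x = (case x of Inl a \<Rightarrow> if a \<in> lcarrier g1 then b1 a else 0
    | Inr a \<Rightarrow> if a \<in> lcarrier g2 then b2 a else 0)" for x
  have g: "g x \<in> lcarrier H" for x
    using leibniz_homD(1)[OF b1(1)] leibniz_homD(1)[OF b2(1)] by (simp add: g_def split: sum.splits)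
  obtain S and K :: "('k, ('g1 + 'g2) list \<Rightarrow> 'k) leibniz" and T
    where S: "leibniz_algebra (H\<lparr>lcarrier := S\<rparr>)" "S \<subseteq> lcarrier H" "\<And>x. g x \<in> S"
      and K: "leibniz_algebra K" "leibniz_iso (H\<lparr>lcarrier := S\<rparr>) K T"
    by (rule H.transport_to_words[of g, OF g]) (rule that)
  let ?H = "H\<lparr>lcarrier := S\<rparr>"
  let ?T = "inv_into S T"
  interpret H': leibniz_algebra ?H by fact
  have i: "leibniz_iso K ?H ?T" using leibniz_iso_inverse[OF S(1) K(2)] by simp
  note hT = leibniz_homD[OF K(2)[unfolded leibniz_iso_def, THEN conjunct1]]
    H'.hom_zero[OF K(2)[unfolded leibniz_iso_def, THEN conjunct1]]
  note hi = leibniz_homD[OF i[unfolded leibniz_iso_def, THEN conjunct1]]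
  have Tinj: "inj_on T S" "T ` S = lcarrier K" using K(2) by (auto simp: leibniz_iso_def bij_betw_def)
  have TT: "?T (T x) = x" if "x \<in> S" for x using that Tinj by simp
  have TK: "T (?T y) = y" "?T y \<in> S" if "y \<in> lcarrier K" for y
    using that Tinj by (auto simp: f_inv_into_f inv_into_into)
  have bS: "x \<in> lcarrier g1 \<Longrightarrow> b1 x \<in> S" "y \<in> lcarrier g2 \<Longrightarrow> b2 y \<in> S" for x y
    using S(3)[of "Inl x"] S(3)[of "Inr y"] by (simp_all add: g_def)
  let ?E = "kernel_ext K (ext_quo E1) (\<lambda>y. p (?T y))"
  have E: "lie_central_extension ?E"
  proof (rule kernel_ext_central[OF K(1) D1(3)])
    show "leibniz_hom K (ext_quo E1) (\<lambda>y. p (?T y))"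
      using hi leibniz_homD[OF p] S(2)[THEN subsetD] by (intro leibniz_homI) simp_all
    then have "(\<lambda>y. p (?T y)) ` lcarrier K \<subseteq> lcarrier (ext_quo E1)" by (auto simp: leibniz_hom_def)
    \<comment> \<open>Shrinking to the generated subalgebra keeps the projection onto the quotient
      surjective, because the image of \<open>g1\<close> alone covers it.\<close>
    moreover have "p1 x \<in> (\<lambda>y. p (?T y)) ` lcarrier K" if "x \<in> lcarrier g1" for x
      using that bS(1)[OF that] b1(3)[OF that] TT imageI[OF bS(1)[OF that], of T] Tinj(2)
      by (intro image_eqI[of _ _ "T (b1 x)"]) simp_all
    ultimately show "(\<lambda>y. p (?T y)) ` lcarrier K = lcarrier (ext_quo E1)"
      by (intro equalityI) (auto simp: D1(8)[symmetric])
    show "lie_sym K x y = 0" if "x \<in> lcarrier K" "p (?T x) = 0" "y \<in> lcarrier K" for x y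
    proof -
      have c: "?T x \<in> S" "?T y \<in> S" using that TK by auto
      then have "lie_sym ?H (?T x) (?T y) = 0" using that central S(2) by (auto simp: H.lie_sym_sub)
      then have "T (lie_sym ?H (?T x) (?T y)) = 0" using hT by simp
      then show ?thesis
        using H'.hom_lie_sym[OF K(2)[unfolded leibniz_iso_def, THEN conjunct1], of "?T x" "?T y"] c that
        by (simp add: TK)
    qed
  qed
  have T0: "x = 0" if "x \<in> S" "T x = 0" for x
    using that Tinj(1) hT(5) H'.carrier_zero by (auto simp: inj_on_def)
  have hom: "leibniz_hom G K (\<lambda>x. T (b x))"
    if "leibniz_hom G H b" "\<And>x. x \<in> lcarrier G \<Longrightarrow> b x \<in> S" for G :: "('k, 'z::ab_group_add) leibniz" and b
    using leibniz_homD[OF that(1)] that(2) hT by (intro leibniz_homI) auto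
  have "lie_isoclinic_mono E1 ?E (\<lambda>n. T (b1 (ext_inc E1 n))) (\<lambda>x. T (b1 x)) (\<lambda>x. x)"
    by (rule kernel_ext_mono[OF E1 E hom[OF b1(1) bS(1)] leibniz_iso_id])
      (use T0[OF bS(1)] b1(2) in \<open>simp_all add: bS TT b1(3)\<close>)
  moreover have "lie_isoclinic_mono E2 ?E (\<lambda>n. T (b2 (ext_inc E2 n))) (\<lambda>x. T (b2 x)) \<gamma>"
    by (rule kernel_ext_mono[OF E2 E hom[OF b2(1) bS(2)] \<gamma>])
      (use T0[OF bS(2)] b2(2) in \<open>simp_all add: bS TT b2(3)\<close>)
  ultimately show ?thesis using E unfolding isoclinic_monos_into_def by blast
qed

end

section \<open>The common extension\<close>

lemma lie_isoclinism_refl: "lie_isoclinism E E (\<lambda>x. x) (\<lambda>x. x)"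
  by (simp add: lie_isoclinism_def leibniz_iso_id)

context isoclinic_pair
begin

definition "N2 = {y \<in> lcarrier g2. p2 y = 0}"

lemma N2_subspace: "G2.subspace N2"
proof -
  interpret Q: leibniz_algebra "ext_quo E2" using lie_central_extensionD[OF E2] by auto
  show ?thesis
    unfolding N2_def using leibniz_homD[OF proj(2)] G2.hom_zero[OF proj(2)]
    by (intro G2.subspaceI) (auto simp: G2.carrier_closed Q.scale_zero_right)
qed

text \<open>The last claim is Lie-centrality of the kernel: the left action of \<open>g2\<close> on
  \<open>N2\<close> determines the right action.\<close>

lemma N2_bracket:
  assumes "n \<in> N2" "x \<in> lcarrier g2"
  shows "bracket g2 n x \<in> N2" "bracket g2 x n \<in> N2" "bracket g2 n x = - bracket g2 x n"
proof -
  interpret Q: leibniz_algebra "ext_quo E2" using lie_central_extensionD[OF E2] by auto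
  show "bracket g2 n x \<in> N2" "bracket g2 x n \<in> N2"
    using assms leibniz_homD[OF proj(2)] by (auto simp: N2_def G2.bracket_closed proj)
  have "lie_sym g2 n x = 0" using assms lie_central_extensionD(9)[OF E2] by (simp add: N2_def)
  then show "bracket g2 n x = - bracket g2 x n" by (simp add: lie_sym_def eq_neg_iff_add_eq_0)
qed

text \<open>Makes the fibre square of \<open>g2\<close> an instance of the same fibre product; with
  the identity as \<xi>, \<open>fibre_derived\<close> places its commutators on the
  diagonal.\<close>

lemma self_pair: "isoclinic_pair E2 E2 (\<lambda>x. x) (\<lambda>x. x)"
  by unfold_locales (rule E2 E2 lie_isoclinism_refl)+

lemma fibre_zero: "(0, n) \<in> lcarrier fibre \<longleftrightarrow> n \<in> N2"
  using G1.hom_zero[OF eta_proj_hom] by (auto simp: N2_def)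

text \<open>Here \<open>s x\<close> is the image of \<open>(x, x)\<close>, an element of \<open>g2 \<times>\<^sub>q g2\<close>.\<close>

lemma kernel_amalgam:
  assumes two: "(2::'k) \<noteq> 0"
  obtains Y :: "('k, (('g1 \<times> 'g2 + 'g2 \<times> 'g2) list \<Rightarrow> 'k) \<Rightarrow> ('g1 \<times> 'g2 + 'g2 \<times> 'g2) list \<Rightarrow> 'k) leibniz"
    and f s
  where "leibniz_algebra Y" "\<And>u v. lie_sym Y u v = 0" "leibniz_hom fibre Y f" "leibniz_hom g2 Y s"
    "\<And>x n. x \<in> lcarrier g2 \<Longrightarrow> n \<in> N2 \<Longrightarrow> bracket Y (s x) (f (0, n)) = f (0, bracket g2 x n)"
    "\<And>x. (x, 0) \<in> lcarrier fibre \<Longrightarrow> f (x, 0) = 0 \<Longrightarrow> x = 0"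
    "\<And>n. n \<in> N2 \<Longrightarrow> s n = f (0, n) \<Longrightarrow> n = 0"
proof -
  interpret S: isoclinic_pair E2 E2 "\<lambda>x. x" "\<lambda>x. x" by (rule self_pair)
  define i :: "'g1 \<times> 'g2 \<Rightarrow> 'g2 \<times> 'g2" where "i z = (snd z, 0)" for z
  define N where "N = {z \<in> lcarrier fibre. fst z = 0}"
  have NN: "z \<in> N \<longleftrightarrow> fst z = 0 \<and> snd z \<in> N2" for z
    using fibre_zero[of "snd z"] by (cases z) (auto simp: N_def)
  have p20: "p2 0 = 0" by (rule G2.hom_zero[OF proj(2)])
  have lin: "Vector_Spaces.linear (lscale fibre) (lscale S.fibre) i"
    by unfold_locales (auto simp: i_def S.fibre_simps G2.scale_zero_right)
  have N: "F.subspace N" "N \<subseteq> lcarrier fibre" "i ` N \<subseteq> lcarrier S.fibre" "inj_on i N"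
    "\<And>x y. x \<in> N \<Longrightarrow> y \<in> N \<Longrightarrow> bracket fibre x y \<in> N"
    "\<And>x y. x \<in> N \<Longrightarrow> y \<in> N \<Longrightarrow> i (bracket fibre x y) = bracket S.fibre (i x) (i y)"
    subgoal
      using G2.subspace_0[OF N2_subspace] G2.subspace_add[OF N2_subspace] G2.subspace_scale[OF N2_subspace]
      by (intro F.subspaceI) (auto simp: NN G1.scale_zero_right)
    subgoal by (auto simp: N_def)
    subgoal by (auto simp: NN i_def S.fibre_simps N2_def p20)
    subgoal by (auto simp: NN i_def inj_on_def prod_eq_iff)
    subgoal using N2_bracket(1) by (auto simp: NN N2_def)
    subgoal by (auto simp: i_def S.fibre_simps)
    done
  have "z = 0" if "z \<in> N" "z \<in> lie_derived fibre" for z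
    using that fibre_derived[of z] xi(5) by (simp add: NN prod_eq_iff)
  then have ND: "N \<inter> lie_derived fibre = {0}"
    using F.subspace_0[OF N(1)] F.subspace_0[OF F.lie_derived_subspace] by blast
  have "i 0 \<in> i ` N" using F.subspace_0[OF N(1)] by blast
  moreover have "i 0 = 0" by (simp add: i_def zero_prod_def)
  moreover have "i z = 0" if "i z \<in> lie_derived S.fibre" for z
    using S.fibre_derived[OF that] by (simp add: i_def zero_prod_def)
  ultimately have NB: "i ` N \<inter> lie_derived S.fibre = {0}"
    using S.F.subspace_0[OF S.F.lie_derived_subspace] by auto
  obtain Y :: "('k, (('g1 \<times> 'g2 + 'g2 \<times> 'g2) list \<Rightarrow> 'k) \<Rightarrow> ('g1 \<times> 'g2 + 'g2 \<times> 'g2) list \<Rightarrow> 'k) leibniz"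
    and f g where Y: "leibniz_algebra Y" "\<And>u v. lie_sym Y u v = 0"
    "leibniz_hom fibre Y f" "leibniz_hom S.fibre Y g" "\<And>x. x \<in> N \<Longrightarrow> f x = g (i x)"
    "\<And>x. x \<in> lcarrier fibre \<Longrightarrow> f x = 0 \<Longrightarrow> x \<in> lie_derived fibre"
    "\<And>x. x \<in> lcarrier S.fibre \<Longrightarrow> g x = 0 \<Longrightarrow> x \<in> lie_derived S.fibre"
    by (rule lie_amalgam_exists[OF two F.leibniz_algebra_axioms S.F.leibniz_algebra_axioms lin N ND NB])
      (assumption | rule that)+
  note gh = leibniz_homD[OF Y(4)]
  have f0: "f (0, n) = g (n, 0)" if "n \<in> N2" for n using Y(5)[of "(0, n)"] that by (simp add: NN i_def)
  have n0: "(n, 0) \<in> lcarrier S.fibre" if "n \<in> N2" for n using that p20 by (simp add: S.fibre_simps N2_def)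
  show ?thesis
  proof (rule that[OF Y(1,2,3)])
    show "leibniz_hom g2 Y (\<lambda>x. g (x, x))"
      using gh(1)[of "(_, _)"] gh(2)[of "(_, _)" "(_, _)"] gh(3)[of "(_, _)"] gh(4)[of "(_, _)" "(_, _)"]
      by (intro leibniz_homI) (simp_all add: S.fibre_simps)
    show "bracket Y (g (x, x)) (f (0, n)) = f (0, bracket g2 x n)" if "x \<in> lcarrier g2" "n \<in> N2" for x n
      using that gh(4)[OF _ n0[OF that(2)], of "(x, x)"] N2_bracket(2)[OF that(2,1)]
      by (simp add: f0 S.fibre_simps)
    \<comment> \<open>The pair (x, 0) lies on the graph of \<xi>, and \<xi> is injective.\<close>
    show "x = 0" if "(x, 0) \<in> lcarrier fibre" "f (x, 0) = 0" for x
      using fibre_derived[OF Y(6)[OF that]] xi(4,5) G1.subspace_0[OF G1.lie_derived_subspace]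
      by (auto simp: inj_on_def)
    show "n = 0" if n: "n \<in> N2" "g (n, n) = f (0, n)" for n
    proof -
      \<comment> \<open>Splitting (n, n) as (0, n) + (n, 0) gives \<open>g (0, n) = 0\<close>; thus
        (0, n) is in the commutator ideal, hence on the diagonal.\<close>
      have c: "(0, n) \<in> lcarrier S.fibre" using n p20 by (simp add: S.fibre_simps N2_def)
      have "g (n, n) = g (0, n) + g (n, 0)" using gh(2)[OF c n0[OF n(1)]] by simp
      then have "g (0, n) = 0" using n f0 by simp
      then show ?thesis using S.fibre_derived[OF Y(7)[OF c]] by simp
    qed
  qed
qed

theorem isoclinic_monos_exist:
  assumes two: "(2::'k) \<noteq> 0"
  shows "\<exists>E :: ('k, ('g1 + 'g2) list \<Rightarrow> 'k, ('g1 + 'g2) list \<Rightarrow> 'k, 'q1) leibniz_ext.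
    isoclinic_monos_into E E1 E2"
proof -
  obtain Y :: "('k, (('g1 \<times> 'g2 + 'g2 \<times> 'g2) list \<Rightarrow> 'k) \<Rightarrow> ('g1 \<times> 'g2 + 'g2 \<times> 'g2) list \<Rightarrow> 'k) leibniz"
    and f s where Y: "leibniz_algebra Y" "\<And>u v. lie_sym Y u v = 0"
      and f: "leibniz_hom fibre Y f" and s: "leibniz_hom g2 Y s"
      and sf: "\<And>x n. x \<in> lcarrier g2 \<Longrightarrow> n \<in> N2 \<Longrightarrow> bracket Y (s x) (f (0, n)) = f (0, bracket g2 x n)"
      and f0: "\<And>x. (x, 0) \<in> lcarrier fibre \<Longrightarrow> f (x, 0) = 0 \<Longrightarrow> x = 0"
      and s0: "\<And>n. n \<in> N2 \<Longrightarrow> s n = f (0, n) \<Longrightarrow> n = 0"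
    by (rule kernel_amalgam[OF two]) (assumption | rule that)+
  interpret Y: leibniz_algebra Y by fact
  interpret Q2: leibniz_algebra "ext_quo E2" using lie_central_extensionD[OF E2] by auto
  interpret P: leibniz_algebra "prod_leibniz Y g2"
    by (rule leibniz_algebra_prod[OF Y(1) G2.leibniz_algebra_axioms])
  interpret PQ: leibniz_algebra "prod_leibniz Y (ext_quo E2)"
    by (rule leibniz_algebra_prod[OF Y(1) Q2.leibniz_algebra_axioms])
  define \<nu> where "\<nu> n = f (0, n)" for n
  have fz: "(0, n) \<in> lcarrier fibre" if "n \<in> N2" for n using that fibre_zero by blast
  note fh = leibniz_homD[OF f]
  have \<nu>: "\<nu> n \<in> lcarrier Y" "\<nu> (lscale g2 a n) = lscale Y a (\<nu> n)" if "n \<in> N2" for n a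
    using fh(1)[OF fz[OF that]] fh(3)[OF fz[OF that]] by (simp_all add: \<nu>_def G1.scale_zero_right)
  have \<nu>_add: "\<nu> (n + m) = \<nu> n + \<nu> m" if "n \<in> N2" "m \<in> N2" for n m
    using fh(2)[OF fz[OF that(1)] fz[OF that(2)]] by (simp add: \<nu>_def)
  have \<nu>_zero: "\<nu> 0 = 0" using \<nu>_add[of 0 0] G2.subspace_0[OF N2_subspace] by simp
  have \<nu>_uminus: "\<nu> (- n) = - \<nu> n" if "n \<in> N2" for n
    using \<nu>_add[OF that G2.subspace_neg[OF N2_subspace that]] \<nu>_zero by (simp add: eq_neg_iff_add_eq_0 add.commute)
  have \<nu>_diff: "\<nu> (n - m) = \<nu> n - \<nu> m" if "n \<in> N2" "m \<in> N2" for n m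
    using \<nu>_add[OF that(1) G2.subspace_neg[OF N2_subspace that(2)]] \<nu>_uminus[OF that(2)] by simp
  have f\<nu>: "bracket Y (f (x, y)) (\<nu> n) = \<nu> (bracket g2 y n)" if "(x, y) \<in> lcarrier fibre" "n \<in> N2" for x y n
    using fh(4)[OF that(1) fz[OF that(2)]] that by (simp add: \<nu>_def)
  have Yanti: "bracket Y u v = - bracket Y v u" for u v
    using Y(2)[of u v] by (simp add: lie_sym_def eq_neg_iff_add_eq_0)

  define A where "A = {z \<in> lcarrier Y \<times> lcarrier g2.
      \<forall>n\<in>N2. bracket Y (fst z) (\<nu> n) = \<nu> (bracket g2 (snd z) n)}"
  define G0 where "G0 = (prod_leibniz Y g2)\<lparr>lcarrier := A\<rparr>"
  have G0: "lcarrier G0 = A" "bracket G0 z w = (bracket Y (fst z) (fst w), bracket g2 (snd z) (snd w))"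
    "lscale G0 a z = (lscale Y a (fst z), lscale g2 a (snd z))"
    "lie_sym G0 z w = (0, lie_sym g2 (snd z) (snd w))" for z w a
    using Y(2) by (simp_all add: G0_def prod_leibniz_def lie_sym_def)
  have N2c: "n \<in> N2 \<Longrightarrow> n \<in> lcarrier g2" for n by (simp add: N2_def)
  \<comment> \<open>On both sides a bracket acts from the left as the commutator of the left
    actions: in \<open>Y\<close> because it is a Lie algebra, on \<open>N2\<close> because of the
    skewness in \<open>N2_bracket\<close>. Equal actions of the factors thus give equal actions of
    the bracket.\<close>
  have Aclosed: "bracket G0 z w \<in> A" if "z \<in> A" "w \<in> A" for z w
  proof -
    have "bracket Y (bracket Y (fst z) (fst w)) (\<nu> n) = \<nu> (bracket g2 (bracket g2 (snd z) (snd w)) n)"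
      if n: "n \<in> N2" for n
    proof -
      have zw: "fst z \<in> lcarrier Y" "fst w \<in> lcarrier Y" "snd z \<in> lcarrier g2" "snd w \<in> lcarrier g2"
        using \<open>z \<in> A\<close> \<open>w \<in> A\<close> by (auto simp: A_def)
      have "bracket Y (bracket Y (fst z) (fst w)) (\<nu> n) =
          bracket Y (fst z) (bracket Y (fst w) (\<nu> n)) + bracket Y (bracket Y (fst z) (\<nu> n)) (fst w)"
        using Y.leibniz_identity[OF zw(1,2) \<nu>(1)[OF n]] by simp
      also have "\<dots> = bracket Y (fst z) (\<nu> (bracket g2 (snd w) n)) + bracket Y (\<nu> (bracket g2 (snd z) n)) (fst w)"
        using \<open>z \<in> A\<close> \<open>w \<in> A\<close> n by (simp add: A_def)
      also have "\<dots> = \<nu> (bracket g2 (snd z) (bracket g2 (snd w) n)) - \<nu> (bracket g2 (snd w) (bracket g2 (snd z) n))"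
        using \<open>z \<in> A\<close> \<open>w \<in> A\<close> N2_bracket(2)[OF n] zw
        by (subst Yanti[of _ "fst w"]) (simp add: A_def)
      also have "\<dots> = \<nu> (bracket g2 (snd z) (bracket g2 (snd w) n) - bracket g2 (snd w) (bracket g2 (snd z) n))"
        using N2_bracket(2)[OF n] N2_bracket(2)[OF _ zw(4)] N2_bracket(2)[OF _ zw(3)] zw \<nu>_diff by simp
      also have "bracket g2 (snd z) (bracket g2 (snd w) n) - bracket g2 (snd w) (bracket g2 (snd z) n)
          = bracket g2 (bracket g2 (snd z) (snd w)) n"
        using G2.leibniz_identity[OF zw(3,4) N2c[OF n]]
          N2_bracket(3)[OF N2_bracket(2)[OF n zw(3)] zw(4)] by simp
      finally show ?thesis .
    qed
    then show ?thesis using that by (auto simp: A_def G0 Y.bracket_closed G2.bracket_closed)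
  qed
  have A0: "leibniz_algebra G0"
    unfolding G0_def
  proof (rule P.subalgebra)
    show "P.subspace A"
      by (rule P.subspaceI)
        (auto simp: A_def prod_leibniz_def zero_prod_def Y.carrier_closed G2.carrier_closed N2c \<nu> \<nu>_zero
          Y.bracket_add_left Y.bracket_scale_left G2.bracket_add_left G2.bracket_scale_left \<nu>_add
          N2_bracket)
    show "bracket (prod_leibniz Y g2) x y \<in> A" if "x \<in> A" "y \<in> A" for x y
      using Aclosed[OF that] by (simp add: G0_def)
  qed (auto simp: A_def prod_leibniz_def)
  interpret G0: leibniz_algebra G0 by (rule A0)

  have "Vector_Spaces.linear (lscale g2) (lscale g2) (\<lambda>x. x)" by unfold_locales simp_all
  then interpret V: vector_space_pair "lscale g2" "lscale g2" by unfold_locales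
  \<comment> \<open>A linear retraction onto \<open>N2\<close>, in general no homomorphism.
    Subtracting the image of the \<open>N2\<close>-part makes the quotient of \<open>G0\<close>
    representable by vectors in the product of \<open>Y\<close> and the quotient of
    \<open>E2\<close>.\<close>
  obtain pr where pr: "range pr \<subseteq> N2" "Vector_Spaces.linear (lscale g2) (lscale g2) pr" "\<And>n. n \<in> N2 \<Longrightarrow> pr n = n"
    using V.linear_exists_left_inverse_on[OF \<open>Vector_Spaces.linear _ _ (\<lambda>x. x)\<close> N2_subspace] by auto
  interpret pr: Vector_Spaces.linear "lscale g2" "lscale g2" pr by (rule pr(2))
  have prN: "pr x \<in> N2" for x using pr(1) by blast

  text \<open>The quotient of \<open>G0\<close> by the ideal of all \<open>(\<nu> n, n)\<close>, realized as the image of a linear map with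
    this kernel.\<close>
  define T where "T z = (fst z - \<nu> (pr (snd z)), p2 (snd z))" for z
  define H where "H = image_leibniz (lscale (prod_leibniz Y (ext_quo E2))) T G0"
  note ph = leibniz_homD[OF proj(2)]
  have T0: "snd z \<in> N2 \<and> fst z = \<nu> (snd z)" if "z \<in> A" "T z = 0" for z
    using that pr(3)[of "snd z"] by (auto simp: T_def A_def N2_def zero_prod_def)
  have T0': "T (\<nu> n, n) = 0" if "n \<in> N2" for n using that pr(3)[OF that] by (simp add: T_def N2_def zero_prod_def)
  have Tideal: "T (bracket G0 z w) = 0 \<and> T (bracket G0 w z) = 0" if "z \<in> A" "T z = 0" "w \<in> A" for z w
  proof -
    let ?n = "snd z"
    have n: "?n \<in> N2" "fst z = \<nu> ?n" using T0 that by auto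
    have w: "snd w \<in> lcarrier g2" using that by (auto simp: A_def)
    have wn: "bracket Y (fst w) (\<nu> ?n) = \<nu> (bracket g2 (snd w) ?n)" using that n by (simp add: A_def)
    \<comment> \<open>\<open>A\<close> prescribes left actions only. The right action follows
      because brackets with \<open>N2\<close> are skew in \<open>g2\<close> and all brackets are
      skew in \<open>Y\<close>.\<close>
    have nw: "bracket Y (\<nu> ?n) (fst w) = \<nu> (bracket g2 ?n (snd w))"
      using N2_bracket[OF n(1) w] \<nu>_uminus wn by (subst Yanti) simp
    show ?thesis using N2_bracket[OF n(1) w] by (simp only: G0 n(2) wn nw T0' simp_thms)
  qed
  have Tadd: "T (z + w) = T z + T w" if "z \<in> lcarrier G0" "w \<in> lcarrier G0" for z w
    using that by (auto simp: G0(1) T_def A_def ph pr.add \<nu>_add prN)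
  have Tscale: "T (lscale G0 a z) = lscale (prod_leibniz Y (ext_quo E2)) a (T z)" if "z \<in> lcarrier G0" for a z
    using that by (auto simp: G0 T_def A_def prod_leibniz_def ph pr.scale \<nu> prN Y.scale_right_diff_distrib)
  have H: "leibniz_algebra H" "leibniz_hom G0 H T"
    unfolding H_def
    by (rule image_leibniz[OF A0 PQ.vector_space_axioms]; (rule Tadd Tscale)?; simp add: G0(1) Tideal)+
  interpret H: leibniz_algebra H by (rule H)
  have HT: "lcarrier H = T ` A" by (simp add: H_def image_leibniz_def G0)
  note Th = leibniz_homD[OF H(2), unfolded G0(1)]

  define \<gamma> where "\<gamma> = inv_into (lcarrier (ext_quo E1)) \<eta>"
  have \<gamma>: "leibniz_iso (ext_quo E2) (ext_quo E1) \<gamma>"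
    unfolding \<gamma>_def by (rule leibniz_iso_inverse[OF lie_central_extensionD(3)[OF E1] eta(3)])
  have \<gamma>h: "leibniz_hom (ext_quo E2) (ext_quo E1) \<gamma>" using \<gamma> by (simp add: leibniz_iso_def)
  have \<gamma>\<eta>: "\<gamma> (\<eta> a) = a" if "a \<in> lcarrier (ext_quo E1)" for a
    using that eta(2) by (simp add: \<gamma>_def bij_betw_def)
  have \<gamma>0: "b = 0" if "b \<in> lcarrier (ext_quo E2)" "\<gamma> b = 0" for b
    using that \<gamma> Q2.hom_zero[OF \<gamma>h] Q2.carrier_zero by (auto simp: leibniz_iso_def bij_betw_def inj_on_def)

  define b2 where "b2 x = T (s x, x)" for x
  define b1 where "b1 x = T (f (x, SOME y. (x, y) \<in> lcarrier fibre), SOME y. (x, y) \<in> lcarrier fibre)" for x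
  have sA: "(s x, x) \<in> A" if "x \<in> lcarrier g2" for x
    using that leibniz_homD(1)[OF s] sf by (simp add: A_def \<nu>_def)
  have fA: "(f z, snd z) \<in> A" if "z \<in> lcarrier fibre" for z
    using that fh(1) f\<nu>[of "fst z" "snd z"] by (simp add: A_def)
  \<comment> \<open>The choice of \<open>y\<close> is immaterial: two choices differ by some n in
    \<open>N2\<close>, and the resulting pairs by (\<nu> n, n), which \<open>T\<close>
    kills.\<close>
  have b1: "b1 x = T (f (x, y), y)" if "(x, y) \<in> lcarrier fibre" for x y
  proof -
    define y' where "y' = (SOME y. (x, y) \<in> lcarrier fibre)"
    have y': "(x, y') \<in> lcarrier fibre" unfolding y'_def using that by (rule someI)
    have n: "y' - y \<in> N2" using that y' G2.hom_diff[OF proj(2)] by (simp add: N2_def G2.carrier_diff)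
    have "f (x, y') = f (x, y) + \<nu> (y' - y)"
      using fh(2)[OF that fz[OF n]] by (simp add: \<nu>_def)
    then have e: "(f (x, y'), y') = (f (x, y), y) + (\<nu> (y' - y), y' - y)" by simp
    have "(\<nu> (y' - y), y' - y) \<in> A" using fA[OF fz[OF n]] by (simp add: \<nu>_def)
    then have "T (f (x, y'), y') = T (f (x, y), y)"
      unfolding e using Th(2)[of "(f (x, y), y)" "(\<nu> (y' - y), y' - y)"] fA[OF that] T0'[OF n] by simp
    then show ?thesis by (simp add: b1_def y'_def)
  qed
  show ?thesis
  proof (rule common_monos_transport[OF H(1) _ _ _ _ _ _ _ _ \<gamma>])
    show "leibniz_hom H (ext_quo E1) (\<lambda>h. \<gamma> (snd h))"
    proof (rule leibniz_homI)
      fix h k assume "h \<in> lcarrier H" "k \<in> lcarrier H"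
      then obtain z w where z: "z \<in> A" "h = T z" and w: "w \<in> A" "k = T w" using HT by auto
      then have c: "snd z \<in> lcarrier g2" "snd w \<in> lcarrier g2" by (auto simp: A_def)
      show "\<gamma> (snd h) \<in> lcarrier (ext_quo E1)"
        using z c leibniz_homD(1)[OF \<gamma>h] proj(4) by (simp add: T_def)
      show "\<gamma> (snd (h + k)) = \<gamma> (snd h) + \<gamma> (snd k)"
        using z w c leibniz_homD(2)[OF \<gamma>h] proj(4) by (simp add: T_def)
      show "\<gamma> (snd (bracket H h k)) = bracket (ext_quo E1) (\<gamma> (snd h)) (\<gamma> (snd k))"
        unfolding z w Th(4)[OF z(1) w(1), symmetric]
        using c leibniz_homD(4)[OF \<gamma>h] proj(4) ph by (simp add: T_def G0)
      show "\<gamma> (snd (lscale H a h)) = lscale (ext_quo E1) a (\<gamma> (snd h))" for a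
        unfolding z Th(3)[OF z(1), symmetric]
        using c leibniz_homD(3)[OF \<gamma>h] proj(4) ph by (simp add: T_def G0)
    qed
    show "lie_sym H h k = 0" if hk: "h \<in> lcarrier H" "\<gamma> (snd h) = 0" "k \<in> lcarrier H" for h k
    proof -
      obtain z w where z: "z \<in> A" "h = T z" and w: "w \<in> A" "k = T w" using HT hk by auto
      have c: "snd z \<in> lcarrier g2" "snd w \<in> lcarrier g2" using z w by (auto simp: A_def)
      have "p2 (snd z) = 0" using hk z c \<gamma>0[OF proj(4)] by (simp add: T_def)
      then have "lie_sym g2 (snd z) (snd w) = 0" using lie_central_extensionD(9)[OF E2] c by simp
      then have "lie_sym G0 z w = 0" by (simp add: G0 zero_prod_def)
      then show ?thesis
        using G0.hom_lie_sym[OF H(2), of z w] z w G0.hom_zero[OF H(2)] by (simp add: G0)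
    qed
    show "leibniz_hom g1 H b1"
    proof (rule leibniz_homI)
      fix x x' assume "x \<in> lcarrier g1" "x' \<in> lcarrier g1"
      then obtain y y' where y: "(x, y) \<in> lcarrier fibre" and y': "(x', y') \<in> lcarrier fibre"
        using fibre_over_left by metis
      note e = b1[OF y] b1[OF y'] and c = fA[OF y] fA[OF y']
      show "b1 x \<in> lcarrier H" using c Th(1) by (simp add: e)
      show "b1 (x + x') = b1 x + b1 x'"
        using b1[of "x + x'" "y + y'"] F.carrier_add[OF y y'] fh(2)[OF y y'] Th(2)[OF c] by (simp add: e)
      show "b1 (bracket g1 x x') = bracket H (b1 x) (b1 x')"
        using b1[of "bracket g1 x x'" "bracket g2 y y'"] F.bracket_closed[OF y y'] fh(4)[OF y y'] Th(4)[OF c]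
        by (simp add: e G0)
      show "b1 (lscale g1 a x) = lscale H a (b1 x)" for a
        using b1[of "lscale g1 a x" "lscale g2 a y"] F.carrier_scale[OF y, of a] fh(3)[OF y] Th(3)[OF c(1)]
        by (simp add: e G0)
    qed
    show "x = 0" if x: "x \<in> lcarrier g1" "b1 x = 0" for x
    proof -
      obtain y where y: "(x, y) \<in> lcarrier fibre" using fibre_over_left x by blast
      \<comment> \<open>A pair in the kernel of \<open>T\<close> has the form (\<nu> y, y). So
        \<open>f (x, y) = f (0, y)\<close>, and subtracting leaves
        \<open>f (x, 0) = 0\<close>.\<close>
      have n: "y \<in> N2" "f (x, y) = \<nu> y" using T0[OF fA[OF y]] x b1[OF y] by simp_all
      have "(x, 0) \<in> lcarrier fibre" using F.carrier_diff[OF y fz[OF n(1)]] by simp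
      moreover have "f (x, 0) = 0"
        using F.hom_diff[OF f y fz[OF n(1)]] n by (simp add: \<nu>_def)
      ultimately show ?thesis by (rule f0)
    qed
    show "\<gamma> (snd (b1 x)) = p1 x" if x: "x \<in> lcarrier g1" for x
    proof -
      obtain y where y: "(x, y) \<in> lcarrier fibre" using fibre_over_left x by blast
      then have "p2 y = \<eta> (p1 x)" by simp
      then show ?thesis using b1[OF y] \<gamma>\<eta> proj(3)[OF x] by (simp add: T_def)
    qed
    show "leibniz_hom g2 H b2"
    proof (rule leibniz_homI)
      fix x x' assume x: "x \<in> lcarrier g2" and x': "x' \<in> lcarrier g2"
      note c = sA[OF x] sA[OF x'] and sh = leibniz_homD[OF s]
      show "b2 x \<in> lcarrier H" using c Th(1) by (simp add: b2_def)
      show "b2 (x + x') = b2 x + b2 x'" using Th(2)[OF c] sh(2)[OF x x'] by (simp add: b2_def)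
      show "b2 (bracket g2 x x') = bracket H (b2 x) (b2 x')"
        using Th(4)[OF c] sh(4)[OF x x'] by (simp add: b2_def G0)
      show "b2 (lscale g2 a x) = lscale H a (b2 x)" for a
        using Th(3)[OF c(1)] sh(3)[OF x] by (simp add: b2_def G0)
    qed
    show "x = 0" if x: "x \<in> lcarrier g2" "b2 x = 0" for x
      using T0[OF sA[OF x(1)]] x(2) s0[of x] by (simp add: b2_def \<nu>_def)
    show "\<gamma> (snd (b2 x)) = \<gamma> (p2 x)" if "x \<in> lcarrier g2" for x by (simp add: b2_def T_def)
  qed
qed

end

text \<open>Existence cannot be quantified over types. The implications from (a) therefore produce
  extensions on explicit types built from the given ones, and the last two conjuncts state the
  converses for extensions on arbitrary types.\<close>

theorem theorem3p17:
  fixes E1 :: "('k::field, 'n1::ab_group_add, 'g1::ab_group_add, 'q1::ab_group_add) leibniz_ext"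
    and E2 :: "('k, 'n2::ab_group_add, 'g2::ab_group_add, 'q2::ab_group_add) leibniz_ext"
  assumes "(2::'k) \<noteq> 0"
    and "lie_central_extension E1" and "lie_central_extension E2"
  shows
    "(lie_isoclinic E1 E2 \<longleftrightarrow>
        (\<exists>E' :: ('k, 'n1 \<times> 'n2, 'g1 \<times> 'g2, 'q1) leibniz_ext. isoclinic_epis_onto E' E1 E2)) \<and>
     (lie_isoclinic E1 E2 \<longleftrightarrow>
        (\<exists>E'' :: ('k, ('g1 + 'g2) list \<Rightarrow> 'k, ('g1 + 'g2) list \<Rightarrow> 'k, 'q1) leibniz_ext.
           isoclinic_monos_into E'' E1 E2)) \<and>
     ((\<exists>E' :: ('k, 'n::ab_group_add, 'g::ab_group_add, 'q::ab_group_add) leibniz_ext.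
         isoclinic_epis_onto E' E1 E2) \<longrightarrow> lie_isoclinic E1 E2) \<and>
     ((\<exists>E'' :: ('k, 'n, 'g, 'q) leibniz_ext.
         isoclinic_monos_into E'' E1 E2) \<longrightarrow> lie_isoclinic E1 E2)"
proof -
  have ab: "(\<exists>E' :: ('k, 'n1 \<times> 'n2, 'g1 \<times> 'g2, 'q1) leibniz_ext. isoclinic_epis_onto E' E1 E2)"
    and ac: "(\<exists>E'' :: ('k, ('g1 + 'g2) list \<Rightarrow> 'k, ('g1 + 'g2) list \<Rightarrow> 'k, 'q1) leibniz_ext.
           isoclinic_monos_into E'' E1 E2)"
    if "lie_isoclinic E1 E2"
  proof -
    obtain \<eta> \<xi> where "lie_isoclinism E1 E2 \<eta> \<xi>" using \<open>lie_isoclinic E1 E2\<close> by (auto simp: lie_isoclinic_def)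
    then interpret isoclinic_pair E1 E2 \<eta> \<xi> using assms by unfold_locales
    show "(\<exists>E' :: ('k, 'n1 \<times> 'n2, 'g1 \<times> 'g2, 'q1) leibniz_ext. isoclinic_epis_onto E' E1 E2)"
      using isoclinic_epis_onto_fibre_ext by blast
    show "(\<exists>E'' :: ('k, ('g1 + 'g2) list \<Rightarrow> 'k, ('g1 + 'g2) list \<Rightarrow> 'k, 'q1) leibniz_ext.
           isoclinic_monos_into E'' E1 E2)"
      using isoclinic_monos_exist assms(1) by blast
  qed
  show ?thesis
    by (intro conjI iffI impI ab ac)
      (auto intro: isoclinic_if_common_epis isoclinic_if_common_monos[OF assms(3)])
qed

end
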